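(* Let $a>b>0$, $c^2=a^2-b^2$, let $\mathcal{E}$ be the ellipse $x^2/a^2+y^2/b^2=1$, and let $C=[x_c,y_c]$ be a point interior to $\mathcal{E}$. Let $\mathcal{T}_\circ$ be the Poncelet family of triangles inscribed in $\mathcal{E}$ and circumscribing a circle centered at $C$, and let $\mathcal{L}_3$ be the (elliptic) locus of the circumcenter $X_3$ over $\mathcal{T}_\circ$. Let $\mathcal{E}_\triangle$ be the ellipse concentric and axis-aligned with $\mathcal{E}$ with semi-axes $a_\triangle=\frac{ac^2}{a^2+3b^2}$ (along $x$) and $b_\triangle=\frac{bc^2}{3a^2+b^2}$ (along $y$). If $C$ lies on $\mathcal{E}_\triangle$, then $C$ is a major vertex of $\mathcal{L}_3$ (an endpoint of its major axis). If $C$ is interior (resp. exterior) to $\mathcal{E}_\triangle$, then $C$ is interior (resp. exterior) to $\mathcal{L}_3$.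
   Context: For each point $C=[x_c,y_c]$ interior to $\mathcal{E}$ there is exactly one circle $\mathcal{K}$ centered at $C$, nested in $\mathcal{E}$, admitting triangles inscribed in $\mathcal{E}$ with all sides tangent to $\mathcal{K}$; its radius is $r=\big(b\sqrt{a^4-c^2x_c^2}-a\sqrt{b^4+c^2y_c^2}\big)/c^2$. By Poncelet's porism every point of $\mathcal{E}$ is then a vertex of exactly one such triangle. $\mathcal{T}_\circ$ is the family of all these triangles; $\mathcal{K}$ is their common incircle. The locus of a triangle center is the set of its positions as the triangle ranges over $\mathcal{T}_\circ$; it is known that $\mathcal{L}_3$ is an ellipse. $\mathcal{E}_\triangle$ is the locus of centroids of all equilateral triangles inscribed in $\mathcal{E}$; when $C\in\mathcal{E}_\triangle$ the family $\mathcal{T}_\circ$ contains an equilateral triangle. *)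

theory Defs
  imports "HOL-Analysis.Analysis"
begin

type_synonym point = "real \<times> real"

(* M is the centre, u and w are the (orthonormal) directions of the axes, and
   p, q are the semi-axes along u and w; the ellipse is the level set 1 of this function. *)
definition ellipse_form :: "point \<Rightarrow> point \<Rightarrow> point \<Rightarrow> real \<Rightarrow> real \<Rightarrow> point \<Rightarrow> real" where
  "ellipse_form M u w p q X = (((X - M) \<bullet> u) / p)\<^sup>2 + (((X - M) \<bullet> w) / q)\<^sup>2"

definition ellipse :: "point \<Rightarrow> point \<Rightarrow> point \<Rightarrow> real \<Rightarrow> real \<Rightarrow> point set" where
  "ellipse M u w p q = {X. ellipse_form M u w p q X = 1}"

definition ellipse_interior :: "point \<Rightarrow> point \<Rightarrow> point \<Rightarrow> real \<Rightarrow> real \<Rightarrow> point set" where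
  "ellipse_interior M u w p q = {X. ellipse_form M u w p q X < 1}"

definition ellipse_exterior :: "point \<Rightarrow> point \<Rightarrow> point \<Rightarrow> real \<Rightarrow> real \<Rightarrow> point set" where
  "ellipse_exterior M u w p q = {X. ellipse_form M u w p q X > 1}"

(* The ellipse x^2/p^2 + y^2/q^2 = 1. *)
abbreviation std_ellipse :: "real \<Rightarrow> real \<Rightarrow> point set" where
  "std_ellipse p q \<equiv> ellipse (0, 0) (1, 0) (0, 1) p q"

abbreviation std_ellipse_interior :: "real \<Rightarrow> real \<Rightarrow> point set" where
  "std_ellipse_interior p q \<equiv> ellipse_interior (0, 0) (1, 0) (0, 1) p q"

abbreviation std_ellipse_exterior :: "real \<Rightarrow> real \<Rightarrow> point set" where
  "std_ellipse_exterior p q \<equiv> ellipse_exterior (0, 0) (1, 0) (0, 1) p q"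

(* For distinct P, Q: the line PQ meets the circle of radius r about C in exactly one point. *)
definition line_tangent :: "point \<Rightarrow> point \<Rightarrow> point \<Rightarrow> real \<Rightarrow> bool" where
  "line_tangent P Q C r \<longleftrightarrow> (\<exists>!T. T \<in> affine hull {P, Q} \<inter> sphere C r)"

(* Triangles, as ordered triples of vertices, inscribed in std_ellipse a b, with all sides
   tangent to a circle centred at C and nested in the ellipse. As the circle lies inside
   the ellipse, a tangency point on a side line automatically lies on the side itself, so
   the circle is the incircle. The radius is not fixed here: for C interior to the ellipse
   exactly one radius admits such triangles. *)
definition poncelet_triangles :: "real \<Rightarrow> real \<Rightarrow> point \<Rightarrow> (point \<times> point \<times> point) set" where
  "poncelet_triangles a b C =
     {(P, Q, R). P \<in> std_ellipse a b \<and> Q \<in> std_ellipse a b \<and> R \<in> std_ellipse a b \<and>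
        \<not> collinear {P, Q, R} \<and>
        (\<exists>r>0. sphere C r \<subseteq> std_ellipse_interior a b \<and>
           line_tangent P Q C r \<and> line_tangent Q R C r \<and> line_tangent R P C r)}"

definition circumcenter :: "point \<Rightarrow> point \<Rightarrow> point \<Rightarrow> point" where
  "circumcenter P Q R = (THE X. dist X P = dist X Q \<and> dist X P = dist X R)"

definition circumcenter_locus :: "real \<Rightarrow> real \<Rightarrow> point \<Rightarrow> point set" where
  "circumcenter_locus a b C =
     {circumcenter P Q R | P Q R. (P, Q, R) \<in> poncelet_triangles a b C}"

end

theory Submission
  imports Defs "HOL-Computational_Algebra.Fundamental_Theorem_Algebra"
begin

text \<open>
  The affine map \<open>(x, y) \<mapsto> x/a + i y/b\<close> turns the outer ellipse into the unit circle and the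
  incircle into an ellipse with foci \<open>f, g\<close> and centre \<open>\<zeta> = (f + g)/2\<close>. The Poncelet triangles
  become the solution sets of the Blaschke equations
  \<open>z (z - f) (z - g) = \<omega> (1 - cnj f z) (1 - cnj g z)\<close> with \<open>|\<omega>| = 1\<close>, so with \<open>p = f g\<close> their
  vertices have sum \<open>2 \<zeta> + \<omega> cnj p\<close> and product \<open>\<omega>\<close>. The circumcentre is a real-linear function
  of the sum plus the conjugate of the product, that is of \<open>2 \<zeta> + \<omega> cnj p + cnj \<omega>\<close>. Hence the
  locus is a linear image of the unit circle, and \<open>C\<close> is inside, on or outside it according to the
  modulus of the \<open>\<omega>\<close> that \<open>C\<close> corresponds to. When this modulus is 1, the images of \<open>\<omega>\<close> and
  \<open>i \<omega>\<close> turn out to be orthogonal, so \<open>C\<close> is a vertex.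
\<close>

section \<open>Tangent chords and the closing condition\<close>

text \<open>
  For \<open>|z| = |w| = 1\<close> this says that the chord \<open>z w\<close> touches the image of the circle of radius
  \<open>r\<close>, where \<open>m = r\<^sup>2 (a\<^sup>2 - b\<^sup>2) / (a\<^sup>2 b\<^sup>2)\<close> is the squared distance from its centre to its foci and
  \<open>k = (a\<^sup>2 + b\<^sup>2) / (a\<^sup>2 - b\<^sup>2)\<close>.
\<close>

definition chord_tangent :: "complex \<Rightarrow> real \<Rightarrow> real \<Rightarrow> complex \<Rightarrow> complex \<Rightarrow> bool" where
  "chord_tangent \<zeta> m k z w \<longleftrightarrow>
     (\<zeta> + z * w * cnj \<zeta> - z - w)\<^sup>2 = 2 * of_real m * of_real k * (z * w) - of_real m * (1 + (z * w)\<^sup>2)"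

text \<open>
  The condition \<open>|1 - cnj f g| = 2 r/b\<close> (the major axis) for the foci \<open>f, g\<close>
  with \<open>(f - \<zeta>)\<^sup>2 = (g - \<zeta>)\<^sup>2 = - m\<close>. As a quadratic equation in \<open>m\<close> it has two positive roots with product
  \<open>(1 - |\<zeta>|\<^sup>2)\<^sup>2\<close>; only the smaller one belongs to a circle nested in the ellipse.
\<close>

definition porism :: "complex \<Rightarrow> real \<Rightarrow> real \<Rightarrow> bool" where
  "porism \<zeta> m k \<longleftrightarrow> m\<^sup>2 - 2 * m * (k - Re (\<zeta>\<^sup>2)) + (1 - (cmod \<zeta>)\<^sup>2)\<^sup>2 = 0"

lemma chord_tangent_sym: "chord_tangent \<zeta> m k z w \<longleftrightarrow> chord_tangent \<zeta> m k w z"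
  by (simp add: chord_tangent_def algebra_simps)

text \<open>Expressing \<open>Re (\<zeta>\<^sup>2)\<close> and \<open>|\<zeta>|\<^sup>2\<close>
  through \<zeta> and its conjugate makes the condition a complex polynomial identity, which can be
  combined with the chord equations.\<close>

lemma porism_complex:
  "porism \<zeta> m k \<longleftrightarrow>
     (of_real m)\<^sup>2 - 2 * of_real m * of_real k + of_real m * (\<zeta>\<^sup>2 + (cnj \<zeta>)\<^sup>2) + (1 - \<zeta> * cnj \<zeta>)\<^sup>2 = 0"
proof -
  have 1: "of_real (2 * Re (\<zeta>\<^sup>2)) = \<zeta>\<^sup>2 + (cnj \<zeta>)\<^sup>2"
    using complex_add_cnj[of "\<zeta>\<^sup>2"] by simp
  have 2: "of_real ((cmod \<zeta>)\<^sup>2) = \<zeta> * cnj \<zeta>"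
    using complex_norm_square[of \<zeta>] by simp
  have "porism \<zeta> m k \<longleftrightarrow>
      complex_of_real (m\<^sup>2 - 2 * m * k + m * (2 * Re (\<zeta>\<^sup>2)) + (1 - (cmod \<zeta>)\<^sup>2)\<^sup>2) = of_real 0"
    unfolding porism_def of_real_eq_iff by (simp add: algebra_simps)
  also have "\<dots> \<longleftrightarrow> (of_real m)\<^sup>2 - 2 * of_real m * of_real k + of_real m * of_real (2 * Re (\<zeta>\<^sup>2))
      + (1 - of_real ((cmod \<zeta>)\<^sup>2))\<^sup>2 = (0::complex)"
    by (simp only: of_real_add of_real_diff of_real_mult of_real_power of_real_1 of_real_0 of_real_numeral)
  finally show ?thesis by (simp only: 1 2)
qed

text \<open>For fixed \<open>z\<close>, tangency is the quadratic \<open>l x\<^sup>2 + d x + h = 0\<close> in the other endpoint \<open>x\<close>;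
  the claims are its Vieta relations. All three coefficients vanish only if \<open>k\<^sup>2 = 1\<close>.\<close>

lemma tangent_chords_from_vertex:
  assumes "m > 0" "k > 1" "z \<noteq> 0" "w \<noteq> 0" "w \<noteq> v"
    and zw: "chord_tangent \<zeta> m k z w" and zv: "chord_tangent \<zeta> m k z v"
  defines "p \<equiv> \<zeta>\<^sup>2 + of_real m"
  defines "l \<equiv> cnj p * z\<^sup>2 - 2 * cnj \<zeta> * z + 1"
  shows "l \<noteq> 0" "z\<^sup>2 - 2 * \<zeta> * z + p = w * v * l"
    "2 * (\<zeta> - z) * (z * cnj \<zeta> - 1) - 2 * of_real m * of_real k * z = - (w + v) * l"
proof -
  define d where "d = 2 * (\<zeta> - z) * (z * cnj \<zeta> - 1) - 2 * of_real m * of_real k * z"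
  define h where "h = z\<^sup>2 - 2 * \<zeta> * z + p"
  have cp: "cnj p = (cnj \<zeta>)\<^sup>2 + of_real m" by (simp add: p_def)
  have qw: "l * w\<^sup>2 + d * w + h = 0"
    using zw unfolding l_def cp chord_tangent_def unfolding d_def h_def p_def by algebra
  have qv: "l * v\<^sup>2 + d * v + h = 0"
    using zv unfolding l_def cp chord_tangent_def unfolding d_def h_def p_def by algebra
  have "(w - v) * (l * (w + v) + d) = 0"
    using qw qv by algebra
  hence "l * (w + v) + d = 0" using \<open>w \<noteq> v\<close> by simp
  hence d: "d = - (w + v) * l" by algebra
  hence h: "h = w * v * l" using qw by algebra
  show "h = w * v * l" by fact
  show "d = - (w + v) * l" by fact
  show "l \<noteq> 0"
  proof
    assume "l = 0"
    with d h have "d = 0" "h = 0" by auto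
    have "(\<zeta> - z)\<^sup>2 = - of_real m" using \<open>h = 0\<close> unfolding h_def p_def by algebra
    moreover have "(z * cnj \<zeta> - 1)\<^sup>2 = - of_real m * z\<^sup>2" using \<open>l = 0\<close> unfolding l_def cp by algebra
    moreover have "2 * ((\<zeta> - z) * (z * cnj \<zeta> - 1)) = 2 * (of_real m * of_real k * z)"
      using \<open>d = 0\<close> unfolding d_def by algebra
    hence "(\<zeta> - z) * (z * cnj \<zeta> - 1) = of_real m * of_real k * z"
      by (subst (asm) mult_cancel_left) simp
    ultimately have "(of_real m * z)\<^sup>2 * ((of_real k)\<^sup>2 - 1) = 0" by algebra
    hence "complex_of_real (k\<^sup>2 - 1) = 0" using assms by simp
    hence "k\<^sup>2 - 1 = 0" by (simp only: of_real_eq_0_iff)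
    thus False using \<open>k > 1\<close> by (simp add: power2_eq_1_iff)
  qed
qed

text \<open>By the Vieta relation for the product of the other two vertices, every vertex is a root
  of the cubic obtained from the Blaschke equation with \<omega> = \<open>z1 * z2 * z3\<close>.
  Comparing this cubic with the monic cubic of the vertices gives the sum; the Vieta relation for
  the sum at one vertex then gives the closing condition.\<close>

lemma tangent_triangle_relations:
  assumes mk: "m > 0" "k > 1" and nz: "z1 \<noteq> 0" "z2 \<noteq> 0" "z3 \<noteq> 0"
    and ne: "z1 \<noteq> z2" "z2 \<noteq> z3" "z3 \<noteq> z1"
    and T: "chord_tangent \<zeta> m k z1 z2" "chord_tangent \<zeta> m k z2 z3" "chord_tangent \<zeta> m k z3 z1"
  shows "z1 + z2 + z3 = 2 * \<zeta> + z1 * z2 * z3 * cnj (\<zeta>\<^sup>2 + of_real m)" and "porism \<zeta> m k"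
proof -
  define p where "p = \<zeta>\<^sup>2 + of_real m"
  define q where "q = cnj p"
  define s where "s = cnj \<zeta>"
  define M where "M = complex_of_real m"
  define K where "K = complex_of_real k"
  have q: "q = s\<^sup>2 + M" by (simp add: q_def p_def s_def M_def)
  have T': "chord_tangent \<zeta> m k z2 z1" "chord_tangent \<zeta> m k z3 z2" "chord_tangent \<zeta> m k z1 z3"
    using T by (simp_all add: chord_tangent_sym)
  note A = tangent_chords_from_vertex[OF mk nz(1) nz(2) ne(2) T(1) T'(3), folded p_def, folded q_def s_def M_def K_def]
  note B = tangent_chords_from_vertex[OF mk nz(2) nz(3) ne(3) T(2) T'(1), folded p_def, folded q_def s_def M_def K_def]
  note C = tangent_chords_from_vertex[OF mk nz(3) nz(1) ne(1) T(3) T'(2), folded p_def, folded q_def s_def M_def K_def]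
  \<comment> \<open>\<alpha> and \<beta> are the coefficient differences of the two cubics, whose
    constant terms agree. The difference z (\<alpha> z - \<beta>) vanishes at the vertices, and two
    distinct nonzero ones already force \<alpha> = 0.\<close>
  define \<alpha> where "\<alpha> = z1 + z2 + z3 - 2 * \<zeta> - z1 * z2 * z3 * q"
  define \<beta> where "\<beta> = z1 * z2 + z2 * z3 + z3 * z1 - p - z1 * z2 * z3 * (2 * s)"
  have "z1 * (\<alpha> * z1 - \<beta>) = 0" using A(2) unfolding \<alpha>_def \<beta>_def by algebra
  moreover have "z2 * (\<alpha> * z2 - \<beta>) = 0" using B(2) unfolding \<alpha>_def \<beta>_def by algebra
  ultimately have "\<alpha> * z1 = \<beta>" "\<alpha> * z2 = \<beta>" using nz by auto
  hence "\<alpha> * (z1 - z2) = 0" by (simp add: algebra_simps)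
  hence \<alpha>: "\<alpha> = 0" using ne by simp
  thus "z1 + z2 + z3 = 2 * \<zeta> + z1 * z2 * z3 * cnj (\<zeta>\<^sup>2 + of_real m)"
    unfolding \<alpha>_def q_def p_def by algebra
  define l where "l = q * z1\<^sup>2 - 2 * s * z1 + 1"
  have 1: "2 * (\<zeta> - z1) * (z1 * s - 1) - 2 * M * K * z1 = - (2 * \<zeta> + z1 * z2 * z3 * q - z1) * l"
    using A(3) \<alpha> unfolding \<alpha>_def l_def by algebra
  have 2: "z2 * z3 * l = z1\<^sup>2 - 2 * \<zeta> * z1 + p" using A(2) unfolding l_def by simp
  \<comment> \<open>With \<open>z2 + z3\<close> and \<open>z2 * z3\<close> eliminated, only
    \<open>z1\<close> is left; after inserting \<open>q\<close> and \<open>p\<close> the identity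
    collapses to \<open>z1\<close> times the porism expression.\<close>
  have "2 * (\<zeta> - z1) * (z1 * s - 1) - 2 * M * K * z1
      = - (2 * \<zeta> - z1) * l - z1 * q * (z1\<^sup>2 - 2 * \<zeta> * z1 + p)"
    using 1 2 by algebra
  hence "z1 * (M\<^sup>2 - 2 * M * K + M * (\<zeta>\<^sup>2 + s\<^sup>2) + (1 - \<zeta> * s)\<^sup>2) = 0"
    unfolding l_def q p_def M_def[symmetric] by algebra
  thus "porism \<zeta> m k" using nz unfolding porism_complex M_def K_def s_def by simp
qed

section \<open>The inner ellipse lies in the unit disc\<close>

lemma Re_power2_le_cmod: "Re (\<zeta>\<^sup>2) \<le> (cmod \<zeta>)\<^sup>2"
  by (metis complex_Re_le_cmod norm_power)

text \<open>The roots are \<open>v - s\<close> and \<open>v + s\<close>, where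
  \<open>v > t > 0\<close> and their product is \<open>t\<^sup>2\<close>; hence both are positive
  and the smaller one lies below \<open>t\<close>.\<close>

lemma porism_root_exists:
  assumes "k > 1" "cmod \<zeta> < 1"
  shows "\<exists>m>0. m < 1 - (cmod \<zeta>)\<^sup>2 \<and> porism \<zeta> m k"
proof -
  define t where "t = 1 - (cmod \<zeta>)\<^sup>2"
  define v where "v = k - Re (\<zeta>\<^sup>2)"
  have t: "t > 0" unfolding t_def using assms(2) by (simp add: power_less_one_iff abs_square_less_1)
  have v: "v > t" unfolding v_def t_def using Re_power2_le_cmod[of \<zeta>] assms(1) by linarith
  define s where "s = sqrt (v\<^sup>2 - t\<^sup>2)"
  have s2: "s\<^sup>2 = v\<^sup>2 - t\<^sup>2" unfolding s_def using v t by (simp add: power_mono)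
  have "s < v" unfolding s_def using v t by (intro real_less_lsqrt) auto
  moreover have "v - t < s" unfolding s_def
  proof (rule real_less_rsqrt)
    have "0 < 2 * t * (v - t)" using v t by simp
    thus "(v - t)\<^sup>2 < v\<^sup>2 - t\<^sup>2" by (simp add: power2_eq_square algebra_simps)
  qed
  moreover have "(v - s)\<^sup>2 - 2 * (v - s) * v + t\<^sup>2 = 0" using s2 by algebra
  ultimately show ?thesis
    by (intro exI[of _ "v - s"]) (simp add: porism_def t_def[symmetric] v_def[symmetric])
qed

text \<open>Two different roots add up to \<open>2 * (k - Re (\<zeta>\<^sup>2))\<close>, which
  exceeds \<open>2 * (1 - (cmod \<zeta>)\<^sup>2)\<close>, so they cannot both lie below the bound.
  This determines the radius of the incircle.\<close>

lemma porism_root_unique: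
  assumes "k > 1" and m: "m < 1 - (cmod \<zeta>)\<^sup>2" "porism \<zeta> m k"
    and m': "m' < 1 - (cmod \<zeta>)\<^sup>2" "porism \<zeta> m' k"
  shows "m = m'"
proof -
  have "(m - m') * (m + m' - 2 * (k - Re (\<zeta>\<^sup>2))) = 0"
    using m(2) m'(2) unfolding porism_def by algebra
  moreover have "m + m' < 2 * (k - Re (\<zeta>\<^sup>2))"
    using m(1) m'(1) assms(1) Re_power2_le_cmod[of \<zeta>] by argo
  ultimately show ?thesis by simp
qed

text \<open>The quadratic is negative at \<open>t / k\<close>, so this point separates the two roots
  and the smaller root is less than it. Together with \<open>porism_cmod\<close> the bound yields
  |\<open>\<zeta>\<^sup>2 + m\<close>| < 1.\<close>

lemma porism_root_bound:
  assumes "k > 1" "m < 1 - (cmod \<zeta>)\<^sup>2" "porism \<zeta> m k" "cmod \<zeta> < 1"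
  shows "m * k < 1 - (cmod \<zeta>)\<^sup>2"
proof (rule ccontr)
  define n where "n = (cmod \<zeta>)\<^sup>2"
  define \<rho> where "\<rho> = Re (\<zeta>\<^sup>2)"
  define t where "t = 1 - n"
  assume "\<not> ?thesis"
  hence 1: "t \<le> m * k" by (simp add: t_def n_def)
  have \<rho>: "\<rho> \<le> n" unfolding \<rho>_def n_def by (rule Re_power2_le_cmod)
  have n: "0 \<le> n" "n < 1" unfolding n_def using assms(4) by (simp_all add: abs_square_less_1)
  have mt: "m < t" using assms(2) by (simp add: t_def n_def)
  have h: "m\<^sup>2 - 2 * m * (k - \<rho>) + t\<^sup>2 = 0"
    using assms(3) by (simp add: porism_def n_def \<rho>_def t_def)
  have k0: "k > 0" using assms(1) by simp
  have m0: "t / k \<le> m" using 1 k0 by (simp add: pos_divide_le_eq)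
  show False
  proof -
    define u where "u = t / k"
    have t: "t = u * k" using k0 u_def by simp
    have u0: "u > 0" using n k0 unfolding u_def t_def by simp
    have "u\<^sup>2 - 2 * u * (k - \<rho>) + t\<^sup>2 < 0"
    proof -
      have "u + k * t - 2 * (k - \<rho>) < 0"
      proof -
        have "k * (u + k * t - 2 * (k - \<rho>)) = 1 - n + k\<^sup>2 * (1 - n) - 2 * k\<^sup>2 + 2 * k * \<rho>"
          using t t_def by algebra
        also have "\<dots> \<le> 1 - n + k\<^sup>2 * (1 - n) - 2 * k\<^sup>2 + 2 * k * n"
          using \<rho> k0 by simp
        also have "\<dots> = (1 - k\<^sup>2) - n * (k - 1)\<^sup>2" by algebra
        also have "\<dots> < 0"
        proof -
          have "1 < k\<^sup>2" using assms(1) by (simp add: one_less_power)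
          thus ?thesis using n by (smt (verit) mult_nonneg_nonneg zero_le_power2)
        qed
        finally show ?thesis using k0 by (simp add: mult_less_0_iff)
      qed
      hence "u * (u + k * t - 2 * (k - \<rho>)) < 0" using u0 by (simp add: mult_less_0_iff)
      moreover have "u * (u + k * t - 2 * (k - \<rho>)) = u\<^sup>2 - 2 * u * (k - \<rho>) + t\<^sup>2"
        using t by algebra
      ultimately show ?thesis by simp
    qed
    moreover have "(u - m) * (u + m - 2 * (k - \<rho>)) = u\<^sup>2 - 2 * u * (k - \<rho>) + t\<^sup>2" using h by algebra
    ultimately have "(u - m) * (u + m - 2 * (k - \<rho>)) < 0" by simp
    moreover have "u \<le> m" using m0 u_def by simp
    moreover have "u + m - 2 * (k - \<rho>) < 0"
      using \<open>u \<le> m\<close> mt \<rho> assms(1) t_def by argo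
    ultimately show False by (simp add: mult_less_0_iff)
  qed
qed

text \<open>The closing condition rewritten for the product of the foci
  \<open>\<zeta> + \<i> h\<close> and \<open>\<zeta> - \<i> h\<close> with
  \<open>h\<^sup>2 = m\<close>.\<close>

lemma porism_cmod:
  assumes "porism \<zeta> m k"
  shows "(cmod (\<zeta>\<^sup>2 + of_real m))\<^sup>2 = 1 - 2 * ((1 - (cmod \<zeta>)\<^sup>2) - m * k)"
  using assms unfolding porism_def cmod_power2
  by (simp add: power2_eq_square) algebra

text \<open>For the squared moduli \<open>F\<close>, \<open>G\<close> of the two foci, 1 -
  \<open>F\<close> and 1 - \<open>G\<close> have positive sum and positive product
  \<open>2 * m * (k - 1)\<close>, so both are positive.\<close>

lemma porism_foci_in_disc:
  assumes "k > 1" "0 < m" "m < 1 - (cmod \<zeta>)\<^sup>2" "porism \<zeta> m k" and h: "h\<^sup>2 = m"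
  shows "cmod (\<zeta> + \<i> * of_real h) < 1"
proof -
  define F where "F = (cmod (\<zeta> + \<i> * of_real h))\<^sup>2"
  define G where "G = (cmod (\<zeta> - \<i> * of_real h))\<^sup>2"
  have "F + G = 2 * (cmod \<zeta>)\<^sup>2 + 2 * m"
    unfolding F_def G_def cmod_power2 h[symmetric] by (simp add: power2_eq_square algebra_simps)
  hence 1: "(1 - F) + (1 - G) > 0" using assms by simp
  have "F * G = (cmod (\<zeta>\<^sup>2 + of_real m))\<^sup>2"
  proof -
    have "(\<zeta> + \<i> * of_real h) * (\<zeta> - \<i> * of_real h) = \<zeta>\<^sup>2 + of_real m"
      unfolding h[symmetric] by (simp add: power2_eq_square algebra_simps)
    thus ?thesis unfolding F_def G_def by (metis norm_mult power_mult_distrib)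
  qed
  hence "(1 - F) * (1 - G) = 2 * m * (k - 1)"
    using porism_cmod[OF assms(4)] \<open>F + G = _\<close> by algebra
  hence "(1 - F) * (1 - G) > 0" using assms by simp
  with 1 have "1 - F > 0" by (smt (verit) zero_less_mult_iff)
  thus ?thesis unfolding F_def by (simp add: abs_square_less_1)
qed

text \<open>Compares numerator and denominator of a Blaschke factor: for |\<open>f\<close>| < 1 the
  sign is that of |\<open>z\<close>| - 1.\<close>

lemma disc_automorphism_cmod:
  "(cmod (z - f))\<^sup>2 - (cmod (1 - cnj f * z))\<^sup>2 = ((cmod z)\<^sup>2 - 1) * (1 - (cmod f)\<^sup>2)"
  unfolding cmod_power2 by (simp add: power2_eq_square algebra_simps)

text \<open>The triangle inequality is applied to 1 - \<open>cnj f * g\<close> =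
  (\<open>z - g\<close>)/\<open>z\<close> + \<open>g\<close> (1 -
  \<open>cnj f * z\<close>)/\<open>z\<close>, with |1 - \<open>cnj f * z\<close>| at most
  |\<open>z - f\<close>|; strictness comes from |\<open>g\<close>| < 1. Hence the ellipse with foci
  \<open>f\<close>, \<open>g\<close> and major axis |1 - \<open>cnj f * g\<close>| lies inside the
  unit disc.\<close>

lemma sum_focal_distances_gt:
  assumes f: "cmod f < 1" and g: "cmod g < 1" and z: "cmod z \<ge> 1"
  shows "cmod (z - f) + cmod (z - g) > cmod (1 - cnj f * g)"
proof -
  have z0: "z \<noteq> 0" "z \<noteq> f" using z f by auto
  have "1 - cnj f * g = (z - g) / z + g * ((1 - cnj f * z) / z)"
    using z0 by (simp add: field_simps)
  hence "cmod (1 - cnj f * g) \<le> cmod (z - g) / cmod z + cmod g * (cmod (1 - cnj f * z) / cmod z)"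
    by (metis norm_divide norm_mult norm_triangle_ineq)
  also have "\<dots> \<le> cmod (z - g) + cmod g * cmod (z - f)"
  proof (intro add_mono mult_left_mono)
    show "cmod (z - g) / cmod z \<le> cmod (z - g)"
      using z by (simp add: divide_le_eq mult_le_cancel_left1)
    have "0 \<le> ((cmod z)\<^sup>2 - 1) * (1 - (cmod f)\<^sup>2)"
      using z f by (intro mult_nonneg_nonneg) (simp_all add: abs_square_le_1)
    hence "(cmod (1 - cnj f * z))\<^sup>2 \<le> (cmod (z - f))\<^sup>2"
      using disc_automorphism_cmod[of z f] by linarith
    hence "cmod (1 - cnj f * z) \<le> cmod (z - f)" by (rule power2_le_imp_le) simp
    moreover have "cmod (z - f) \<le> cmod (z - f) * cmod z"
      using z by (simp add: mult_le_cancel_left1)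
    moreover have "cmod z > 0" using z0 by simp
    ultimately show "cmod (1 - cnj f * z) / cmod z \<le> cmod (z - f)"
      by (subst pos_divide_le_eq) auto
  qed simp
  also have "cmod g * cmod (z - f) < cmod (z - f)" using g z0 by simp
  finally show ?thesis by simp
qed

text \<open>\<open>A\<close> and \<open>B\<close> are the semi-axes of the inner ellipse, whose foci
  lie vertically above and below \<zeta> because \<open>B\<^sup>2 - A\<^sup>2 = m\<close>. Its focal
  sum 2|\<open>B\<close>| equals |1 - \<open>cnj f * g\<close>| by the closing condition, so no
  point of it can have modulus at least 1.\<close>

lemma porism_inner_ellipse:
  assumes "k > 1" "0 < m" "m < 1 - (cmod \<zeta>)\<^sup>2" "porism \<zeta> m k"
    and A: "A\<^sup>2 = m * (k - 1) / 2" and B: "B\<^sup>2 = m * (k + 1) / 2" and pq: "p\<^sup>2 + q\<^sup>2 = 1"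
  shows "cmod (\<zeta> + Complex (A * p) (B * q)) < 1"
proof (rule ccontr)
  define z where "z = \<zeta> + Complex (A * p) (B * q)"
  define h where "h = sqrt m"
  have h: "h\<^sup>2 = m" using assms by (simp add: h_def)
  define f where "f = \<zeta> + \<i> * of_real h"
  define g where "g = \<zeta> - \<i> * of_real h"
  assume "\<not> ?thesis"
  hence "cmod z \<ge> 1" by (simp add: z_def)
  moreover have "cmod f < 1" unfolding f_def by (rule porism_foci_in_disc[OF assms(1-4) h])
  moreover have "cmod g < 1" using porism_foci_in_disc[OF assms(1-4), of "- h"] h by (simp add: g_def)
  ultimately have gt: "cmod (z - f) + cmod (z - g) > cmod (1 - cnj f * g)"
    by (intro sum_focal_distances_gt)
  have AB: "B\<^sup>2 - A\<^sup>2 = h\<^sup>2" unfolding A B h by (simp add: field_simps)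
  have "B\<^sup>2 > h\<^sup>2" unfolding B h using assms by simp
  hence Bh: "\<bar>B\<bar> > \<bar>h\<bar>" by (meson abs_le_square_iff linorder_not_le)
  have q1: "\<bar>q\<bar> \<le> 1" using pq by (metis abs_square_le_1 le_add_same_cancel2 zero_le_power2)
  have hq: "\<bar>h * q\<bar> \<le> \<bar>h\<bar>" using q1 by (simp add: abs_mult mult_left_le)
  have "(cmod (z - f))\<^sup>2 = (B - h * q)\<^sup>2"
    unfolding z_def f_def cmod_power2 using AB pq by simp algebra
  hence 1: "cmod (z - f) = \<bar>B - h * q\<bar>" by (metis abs_norm_cancel power2_eq_iff_nonneg abs_ge_zero norm_ge_zero power2_abs)
  have "(cmod (z - g))\<^sup>2 = (B + h * q)\<^sup>2"
    unfolding z_def g_def cmod_power2 using AB pq by simp algebra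
  hence 2: "cmod (z - g) = \<bar>B + h * q\<bar>" by (metis abs_norm_cancel power2_eq_iff_nonneg abs_ge_zero norm_ge_zero power2_abs)
  have 3: "cmod (z - f) + cmod (z - g) = 2 * \<bar>B\<bar>" unfolding 1 2 using Bh hq by linarith
  have "(cmod (1 - cnj f * g))\<^sup>2 = 2 * m * (k + 1)"
    using assms(4) unfolding porism_def f_def g_def cmod_power2 h[symmetric]
    by (simp add: power2_eq_square) algebra
  hence "(cmod (1 - cnj f * g))\<^sup>2 = (2 * \<bar>B\<bar>)\<^sup>2" using B by (simp add: power_mult_distrib)
  hence "cmod (1 - cnj f * g) = 2 * \<bar>B\<bar>" by (rule power2_eq_imp_eq) auto
  with gt 3 show False by simp
qed

text \<open>A double point would make the tangent of the unit circle at \<open>z\<close> a tangent of the inner ellipse.\<close>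

lemma porism_not_tangent_at_point:
  assumes "k > 1" "0 < m" "m < 1 - (cmod \<zeta>)\<^sup>2" "porism \<zeta> m k" "cmod \<zeta> < 1" "cmod z = 1"
  shows "\<not> chord_tangent \<zeta> m k z z"
proof
  assume T: "chord_tangent \<zeta> m k z z"
  define A where "A = sqrt (m * (k - 1) / 2)"
  define B where "B = sqrt (m * (k + 1) / 2)"
  have A: "A\<^sup>2 = m * (k - 1) / 2" and B: "B\<^sup>2 = m * (k + 1) / 2" and AB0: "A > 0" "B > 0"
    using assms by (simp_all add: A_def B_def)
  define x where "x = Re z" define y where "y = Im z"
  \<comment> \<open>\<open>d\<close> is the distance from \<zeta> to the tangent line of the unit
    circle at \<open>z\<close>. Tangency turns into
    \<open>d\<^sup>2 = (A * x)\<^sup>2 + (B * y)\<^sup>2\<close>: the distance equals the support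
    function of the inner ellipse in the direction \<open>z\<close>.\<close>
  define d where "d = 1 - (x * Re \<zeta> + y * Im \<zeta>)"
  have zc: "z * cnj z = 1" using assms(6) by (simp add: complex_norm_square[symmetric])
  have xy: "x\<^sup>2 + y\<^sup>2 = 1" using assms(6) by (simp add: x_def y_def cmod_def)
  have D: "of_real (2 * d) = 2 - \<zeta> * cnj z - cnj \<zeta> * z"
    by (simp add: complex_eq_iff d_def x_def y_def algebra_simps)
  have X: "of_real (2 * (x\<^sup>2 - y\<^sup>2)) = z\<^sup>2 + (cnj z)\<^sup>2"
    by (simp add: complex_eq_iff x_def y_def algebra_simps power2_eq_square)
  have "(2 - \<zeta> * cnj z - cnj \<zeta> * z)\<^sup>2 = 2 * of_real m * of_real k - of_real m * (z\<^sup>2 + (cnj z)\<^sup>2)"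
    using T zc unfolding chord_tangent_def by algebra
  hence "complex_of_real ((2 * d)\<^sup>2) = of_real (2 * m * k - m * (2 * (x\<^sup>2 - y\<^sup>2)))"
    unfolding of_real_power D of_real_diff of_real_mult[of m] X by simp
  hence "(2 * d)\<^sup>2 = 2 * m * k - m * (2 * (x\<^sup>2 - y\<^sup>2))" by (simp only: of_real_eq_iff)
  hence d2: "d\<^sup>2 = (A * x)\<^sup>2 + (B * y)\<^sup>2"
    using A B xy by (simp add: power_mult_distrib) algebra
  have dot: "x * Re w + y * Im w \<le> cmod w" for w
  proof -
    have "x * Re w + y * Im w = Re (cnj z * w)" by (simp add: x_def y_def)
    also have "\<dots> \<le> cmod (cnj z * w)" by (rule complex_Re_le_cmod)
    also have "\<dots> = cmod w" using assms(6) by (simp add: norm_mult)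
    finally show ?thesis .
  qed
  have d0: "d > 0" using dot[of \<zeta>] assms(5) by (simp add: d_def)
  \<comment> \<open>\<open>p\<close> and \<open>q\<close> give the point where the inner ellipse
    touches this line. It would lie on the line and strictly inside the disc, which is
    impossible.\<close>
  define p where "p = A * x / d" define q where "q = B * y / d"
  have "p\<^sup>2 + q\<^sup>2 = 1" unfolding p_def q_def power_divide add_divide_distrib[symmetric] d2[symmetric]
    using d0 by simp
  from porism_inner_ellipse[OF assms(1-4) A B this]
  have "x * Re (\<zeta> + Complex (A * p) (B * q)) + y * Im (\<zeta> + Complex (A * p) (B * q)) < 1"
    using dot by (meson le_less_trans)
  moreover have "x * (A * p) + y * (B * q) = d"
  proof -
    have "x * (A * p) + y * (B * q) = ((A * x)\<^sup>2 + (B * y)\<^sup>2) / d"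
      by (simp add: p_def q_def power2_eq_square add_divide_distrib algebra_simps)
    also have "\<dots> = d" unfolding d2[symmetric] using d0 by (simp add: power2_eq_square)
    finally show ?thesis .
  qed
  ultimately show False by (simp add: d_def algebra_simps)
qed

section \<open>Blaschke equations\<close>

lemma complex_cubic_roots:
  fixes e1 e2 e3 :: complex
  obtains z1 z2 z3 where "z1 + z2 + z3 = e1" "z1 * z2 + z2 * z3 + z3 * z1 = e2" "z1 * z2 * z3 = e3"
proof -
  have "degree [:- e3, e2, - e1, 1:] = 3" by simp
  hence "\<not> constant (poly [:- e3, e2, - e1, 1:])" by (simp add: constant_degree)
  then obtain z1 where z1: "poly [:- e3, e2, - e1, 1:] z1 = 0"
    using fundamental_theorem_of_algebra by blast
  define u where "u = e1 - z1"
  define v where "v = e2 - z1 * u"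
  define d where "d = csqrt (u\<^sup>2 - 4 * v)"
  have d: "d\<^sup>2 = u\<^sup>2 - 4 * v" by (simp add: d_def)
  define w1 where "w1 = (u + d) / 2"
  define w2 where "w2 = (u - d) / 2"
  have 1: "w1 + w2 = u" by (simp add: w1_def w2_def field_simps)
  have "w1 * w2 = (u\<^sup>2 - d\<^sup>2) / 4" by (simp add: w1_def w2_def field_simps power2_eq_square)
  hence 2: "w1 * w2 = v" by (simp add: d)
  have "z1 ^ 3 - e1 * z1\<^sup>2 + e2 * z1 - e3 = 0"
    using z1 by (simp add: algebra_simps power2_eq_square power3_eq_cube)
  hence 3: "z1 * v = e3" unfolding v_def u_def by algebra
  show ?thesis
  proof (rule that[of z1 w1 w2])
    show "z1 + w1 + w2 = e1" using 1 unfolding u_def by (simp add: algebra_simps)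
    have "z1 * w1 + w1 * w2 + w2 * z1 = z1 * (w1 + w2) + w1 * w2" by algebra
    thus "z1 * w1 + w1 * w2 + w2 * z1 = e2" unfolding 1 2 v_def by simp
    show "z1 * w1 * w2 = e3" using 2 3 by (simp add: mult.assoc)
  qed
qed

text \<open>Inside the disc both Blaschke factors have modulus at most 1 and the extra factor
  \<open>z\<close> makes the product strictly smaller than 1; outside, the inequalities are
  reversed.\<close>

lemma blaschke_equation_cmod:
  assumes f: "cmod f < 1" and g: "cmod g < 1" and l: "cmod \<omega> = 1"
    and eq: "z * ((z - f) * (z - g)) = \<omega> * ((1 - cnj f * z) * (1 - cnj g * z))"
  shows "cmod z = 1"
proof -
  have *: "cmod z * (cmod (z - f) * cmod (z - g)) = cmod (1 - cnj f * z) * cmod (1 - cnj g * z)"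
    using arg_cong[OF eq, of cmod] l by (simp add: norm_mult)
  have lt: "cmod (z - f) \<le> cmod (1 - cnj f * z) \<and> 0 < cmod (1 - cnj f * z)"
    if "cmod z < 1" "cmod f < 1" for f
  proof
    have "((cmod z)\<^sup>2 - 1) * (1 - (cmod f)\<^sup>2) \<le> 0"
      using that by (intro mult_nonpos_nonneg) (simp_all add: abs_square_le_1)
    hence "(cmod (z - f))\<^sup>2 \<le> (cmod (1 - cnj f * z))\<^sup>2"
      using disc_automorphism_cmod[of z f] by linarith
    thus "cmod (z - f) \<le> cmod (1 - cnj f * z)" by (rule power2_le_imp_le) simp
    have "cmod (cnj f * z) < 1"
      using that by (simp add: norm_mult) (metis mult_strict_mono' norm_ge_zero mult_1)
    hence "cnj f * z \<noteq> 1" by auto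
    thus "0 < cmod (1 - cnj f * z)" by simp
  qed
  have gt: "cmod (1 - cnj f * z) \<le> cmod (z - f) \<and> 0 < cmod (z - f)"
    if "cmod z > 1" "cmod f < 1" for f
  proof
    have "((cmod z)\<^sup>2 - 1) * (1 - (cmod f)\<^sup>2) \<ge> 0"
      using that by (intro mult_nonneg_nonneg) (simp_all add: abs_square_le_1)
    hence "(cmod (1 - cnj f * z))\<^sup>2 \<le> (cmod (z - f))\<^sup>2"
      using disc_automorphism_cmod[of z f] by linarith
    thus "cmod (1 - cnj f * z) \<le> cmod (z - f)" by (rule power2_le_imp_le) simp
    show "0 < cmod (z - f)" using that by auto
  qed
  show ?thesis
  proof (rule ccontr)
    assume "cmod z \<noteq> 1"
    then consider "cmod z < 1" | "cmod z > 1" by linarith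
    thus False
    proof cases
      case 1
      let ?r = "cmod (1 - cnj f * z) * cmod (1 - cnj g * z)"
      have "cmod (z - f) * cmod (z - g) \<le> ?r"
        using lt[OF 1 f] lt[OF 1 g] by (intro mult_mono) auto
      hence "?r \<le> cmod z * ?r" unfolding *[symmetric] by (intro mult_left_mono) (auto simp: *)
      moreover have "0 < ?r" using lt[OF 1 f] lt[OF 1 g] by simp
      hence "cmod z * ?r < 1 * ?r" using 1 by (intro mult_strict_right_mono)
      ultimately show False by simp
    next
      case 2
      let ?r = "cmod (z - f) * cmod (z - g)"
      have "cmod (1 - cnj f * z) * cmod (1 - cnj g * z) \<le> ?r"
        using gt[OF 2 f] gt[OF 2 g] by (intro mult_mono) auto
      moreover have "0 < ?r" using gt[OF 2 f] gt[OF 2 g] by simp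
      hence "1 * ?r < cmod z * ?r" using 2 by (intro mult_strict_right_mono)
      ultimately show False using * by simp
    qed
  qed
qed

text \<open>Converse of the elimination in \<open>tangent_triangle_relations\<close>: the symmetric
  functions and the closing condition reproduce both Vieta relations at \<open>z1\<close>, so
  \<open>z2\<close> is a root of the tangency quadratic of \<open>z1\<close>.\<close>

lemma chord_tangent_of_relations:
  fixes z1 z2 z3 \<zeta> :: complex and m k :: real
  defines "p \<equiv> \<zeta>\<^sup>2 + of_real m"
  assumes nz: "z1 \<noteq> 0" "z2 \<noteq> 0" "z3 \<noteq> 0" and P: "porism \<zeta> m k"
    and e1: "z1 + z2 + z3 = 2 * \<zeta> + z1 * z2 * z3 * cnj p"
    and e2: "z1 * z2 + z2 * z3 + z3 * z1 = p + z1 * z2 * z3 * (2 * cnj \<zeta>)"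
  shows "chord_tangent \<zeta> m k z1 z2"
proof -
  define q where "q = cnj p"
  define s where "s = cnj \<zeta>"
  define M where "M = complex_of_real m"
  define K where "K = complex_of_real k"
  have q: "q = s\<^sup>2 + M" and p: "p = \<zeta>\<^sup>2 + M" by (simp_all add: q_def p_def s_def M_def)
  have P': "M\<^sup>2 - 2 * M * K + M * (\<zeta>\<^sup>2 + s\<^sup>2) + (1 - \<zeta> * s)\<^sup>2 = 0"
    using P by (simp add: porism_complex M_def K_def s_def)
  define l where "l = q * z1\<^sup>2 - 2 * s * z1 + 1"
  define d where "d = 2 * (\<zeta> - z1) * (z1 * s - 1) - 2 * M * K * z1"
  define h where "h = z1\<^sup>2 - 2 * \<zeta> * z1 + p"
  have "z1 * (h - z2 * z3 * l) = 0"
    using e1 e2 unfolding h_def l_def q_def[symmetric] s_def[symmetric] by algebra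
  hence h: "h = z2 * z3 * l" using nz by simp
  have "d = - (2 * \<zeta> - z1) * l - z1 * q * h"
    using P' unfolding h_def l_def d_def q p by algebra
  hence "d = - (z2 + z3) * l" using h e1 unfolding q_def[symmetric] by algebra
  hence "l * z2\<^sup>2 + d * z2 + h = 0" using h by algebra
  thus ?thesis
    unfolding chord_tangent_def M_def[symmetric] K_def[symmetric] s_def[symmetric] l_def d_def h_def q p
    by algebra
qed

text \<open>The vertices are the roots of the Blaschke cubic for \<omega>. They are unimodular since
  the foci lie in the disc, and distinct since a double root would be a tangent chord of length
  zero.\<close>

lemma tangent_triangle_exists:
  assumes P: "k > 1" "0 < m" "m < 1 - (cmod \<zeta>)\<^sup>2" "porism \<zeta> m k" "cmod \<zeta> < 1" and l: "cmod \<omega> = 1"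
  obtains z1 z2 z3 where "cmod z1 = 1" "cmod z2 = 1" "cmod z3 = 1" "z1 \<noteq> z2" "z2 \<noteq> z3" "z3 \<noteq> z1"
    "chord_tangent \<zeta> m k z1 z2" "chord_tangent \<zeta> m k z2 z3" "chord_tangent \<zeta> m k z3 z1"
    "z1 + z2 + z3 = 2 * \<zeta> + \<omega> * cnj (\<zeta>\<^sup>2 + of_real m)" "z1 * z2 * z3 = \<omega>"
proof -
  define p where "p = \<zeta>\<^sup>2 + of_real m"
  obtain z1 z2 z3 where e: "z1 + z2 + z3 = 2 * \<zeta> + \<omega> * cnj p"
      "z1 * z2 + z2 * z3 + z3 * z1 = p + \<omega> * (2 * cnj \<zeta>)" "z1 * z2 * z3 = \<omega>"
    by (rule complex_cubic_roots)
  define h where "h = sqrt m"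
  have h: "h\<^sup>2 = m" using P by (simp add: h_def)
  define f where "f = \<zeta> + \<i> * of_real h"
  define g where "g = \<zeta> - \<i> * of_real h"
  have f1: "cmod f < 1" unfolding f_def by (rule porism_foci_in_disc[OF P(1-4) h])
  have g1: "cmod g < 1" using porism_foci_in_disc[OF P(1-4), of "- h"] h by (simp add: g_def)
  have fg: "f + g = 2 * \<zeta>" "f * g = p"
    unfolding f_def g_def p_def h[symmetric] by (simp_all add: power2_eq_square algebra_simps)
  have cfg: "cnj f + cnj g = 2 * cnj \<zeta>" "cnj f * cnj g = cnj p"
    using arg_cong[OF fg(1), of cnj] arg_cong[OF fg(2), of cnj] by simp_all
  have unit: "cmod z = 1" if "(z - z1) * (z - z2) * (z - z3) = 0" for z
  proof (rule blaschke_equation_cmod[OF f1 g1 l])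
    show "z * ((z - f) * (z - g)) = \<omega> * ((1 - cnj f * z) * (1 - cnj g * z))"
      using that e fg cfg by algebra
  qed
  have u: "cmod z1 = 1" "cmod z2 = 1" "cmod z3 = 1" by (simp_all add: unit)
  hence nz: "z1 \<noteq> 0" "z2 \<noteq> 0" "z3 \<noteq> 0" by auto
  have T: "chord_tangent \<zeta> m k z1 z2" "chord_tangent \<zeta> m k z2 z3" "chord_tangent \<zeta> m k z3 z1"
    using e by (auto intro!: chord_tangent_of_relations[OF nz P(4)]
        chord_tangent_of_relations[OF nz(2,3,1) P(4)] chord_tangent_of_relations[OF nz(3,1,2) P(4)]
        simp: p_def mult_ac add_ac)
  moreover have "z1 \<noteq> z2" "z2 \<noteq> z3" "z3 \<noteq> z1"
    using T porism_not_tangent_at_point[OF P] u by auto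
  ultimately show ?thesis using that u e(1,3) unfolding p_def by blast
qed

section \<open>Circles, tangents and circumcentres in ellipse coordinates\<close>

definition param :: "real \<Rightarrow> real \<Rightarrow> complex \<Rightarrow> point" where
  "param a b z = (a * Re z, b * Im z)"

lemma param_cases:
  assumes "a \<noteq> 0" "b \<noteq> 0"
  obtains z where "X = param a b z"
proof
  show "X = param a b (Complex (fst X / a) (snd X / b))" using assms by (simp add: param_def)
qed

lemma param_eq_iff: "a \<noteq> 0 \<Longrightarrow> b \<noteq> 0 \<Longrightarrow> param a b z = param a b w \<longleftrightarrow> z = w"
  by (simp add: param_def complex_eq_iff)

lemma ellipse_form_param:
  assumes "a \<noteq> 0" "b \<noteq> 0"
  shows "ellipse_form (0, 0) (1, 0) (0, 1) a b (param a b z) = (cmod z)\<^sup>2"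
  using assms by (simp add: ellipse_form_def param_def cmod_power2)

lemma param_in_std_ellipse:
  "a \<noteq> 0 \<Longrightarrow> b \<noteq> 0 \<Longrightarrow> param a b z \<in> std_ellipse a b \<longleftrightarrow> cmod z = 1"
  by (simp add: ellipse_def ellipse_form_param abs_square_eq_1)

lemma param_in_std_ellipse_interior:
  "a \<noteq> 0 \<Longrightarrow> b \<noteq> 0 \<Longrightarrow> param a b z \<in> std_ellipse_interior a b \<longleftrightarrow> cmod z < 1"
  by (simp add: ellipse_interior_def ellipse_form_param abs_square_less_1)

section \<open>Tangency of a line to a circle as a polynomial condition\<close>

lemma quadratic_unique_root_iff:
  fixes A B C :: real
  assumes "A > 0"
  shows "(\<exists>!s. A * s\<^sup>2 + 2 * B * s + C = 0) \<longleftrightarrow> B\<^sup>2 = A * C"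
proof
  assume ex1: "\<exists>!s. A * s\<^sup>2 + 2 * B * s + C = 0"
  then obtain s where s: "A * s\<^sup>2 + 2 * B * s + C = 0" by blast
  define s' where "s' = - 2 * B / A - s"
  have As': "A * s' = - 2 * B - A * s" using assms by (simp add: s'_def field_simps)
  have "A * (A * s'\<^sup>2 + 2 * B * s' + C) = 0" using As' s by algebra
  hence "A * s'\<^sup>2 + 2 * B * s' + C = 0" using assms by simp
  hence "s' = s" using ex1 s by blast
  hence "B = - A * s" using As' by simp
  thus "B\<^sup>2 = A * C" using s by algebra
next
  assume BC: "B\<^sup>2 = A * C"
  have "A * s\<^sup>2 + 2 * B * s + C = 0 \<longleftrightarrow> s = - B / A" for s
  proof -
    have "A * s\<^sup>2 + 2 * B * s + C = 0 \<longleftrightarrow> A * (A * s\<^sup>2 + 2 * B * s + C) = 0" using assms by simp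
    also have "A * (A * s\<^sup>2 + 2 * B * s + C) = (A * s + B)\<^sup>2" using BC by algebra
    also have "(A * s + B)\<^sup>2 = 0 \<longleftrightarrow> s = - B / A" using assms by (simp add: field_simps) linarith
    finally show ?thesis .
  qed
  thus "\<exists>!s. A * s\<^sup>2 + 2 * B * s + C = 0" by simp
qed

lemma ex1_range_iff:
  assumes "inj f"
  shows "(\<exists>!y. y \<in> range f \<and> P y) \<longleftrightarrow> (\<exists>!x. P (f x))"
proof
  assume *: "\<exists>!y. y \<in> range f \<and> P y"
  then obtain x where "P (f x)" by blast
  moreover have "x' = x" if "P (f x')" for x'
    using * that \<open>P (f x)\<close> injD[OF assms] by blast
  ultimately show "\<exists>!x. P (f x)" by blast
next
  assume "\<exists>!x. P (f x)"
  thus "\<exists>!y. y \<in> range f \<and> P y" by blast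
qed

text \<open>Tangency is a vanishing discriminant of the quadratic that cuts the line with the
  circle. Lagrange's identity rewrites it with the cross product, that is, as distance
  \<open>r\<close> from the centre to the line.\<close>

lemma line_tangent_iff:
  fixes px py qx qy cx cy r :: real
  assumes "(px, py) \<noteq> (qx, qy)" "r > 0"
  shows "line_tangent (px, py) (qx, qy) (cx, cy) r \<longleftrightarrow>
    ((px - cx) * (qy - py) - (py - cy) * (qx - px))\<^sup>2 = r\<^sup>2 * ((qx - px)\<^sup>2 + (qy - py)\<^sup>2)"
proof -
  define F where "F s = (px, py) + s *\<^sub>R ((qx, qy) - (px, py))" for s :: real
  have inj: "inj F" using assms(1) by (auto simp: F_def inj_def)
  have hull: "affine hull {(px, py), (qx, qy)} = range F"
    by (force simp: affine_hull_2_alt F_def)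
  define A where "A = (qx - px)\<^sup>2 + (qy - py)\<^sup>2"
  define B where "B = (px - cx) * (qx - px) + (py - cy) * (qy - py)"
  define C where "C = (px - cx)\<^sup>2 + (py - cy)\<^sup>2 - r\<^sup>2"
  have A: "A > 0" unfolding A_def using assms(1) by (auto simp: sum_power2_gt_zero_iff)
  have on: "F s \<in> sphere (cx, cy) r \<longleftrightarrow> A * s\<^sup>2 + 2 * B * s + C = 0" for s
  proof -
    have "F s \<in> sphere (cx, cy) r \<longleftrightarrow> (dist (cx, cy) (F s))\<^sup>2 = r\<^sup>2"
      using assms(2) by (simp add: power2_eq_iff_nonneg)
    also have "(dist (cx, cy) (F s))\<^sup>2 = (cx - (px + s * (qx - px)))\<^sup>2 + (cy - (py + s * (qy - py)))\<^sup>2"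
      by (simp add: F_def dist_Pair_Pair dist_real_def)
    also have "\<dots> = A * s\<^sup>2 + 2 * B * s + C + r\<^sup>2"
      unfolding A_def B_def C_def by algebra
    finally show ?thesis by simp
  qed
  have "line_tangent (px, py) (qx, qy) (cx, cy) r \<longleftrightarrow> (\<exists>!s. A * s\<^sup>2 + 2 * B * s + C = 0)"
    unfolding line_tangent_def hull Int_iff on[symmetric] by (rule ex1_range_iff[OF inj])
  also have "\<dots> \<longleftrightarrow> B\<^sup>2 = A * C" by (rule quadratic_unique_root_iff[OF A])
  also have "\<dots> \<longleftrightarrow> ((px - cx) * (qy - py) - (py - cy) * (qx - px))\<^sup>2 = r\<^sup>2 * A"
  proof -
    have "B\<^sup>2 - A * C = r\<^sup>2 * A - ((px - cx) * (qy - py) - (py - cy) * (qx - px))\<^sup>2"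
      unfolding A_def B_def C_def by algebra
    thus ?thesis by auto
  qed
  finally show ?thesis by (simp add: A_def)
qed

text \<open>On the unit circle conjugates are inverses, so after multiplication by
  \<open>z * w\<close> the cross product and both components of the chord become multiples of
  \<open>w - z\<close>. Cancelling its square leaves the chord equation.\<close>

lemma line_tangent_param_iff:
  assumes ab: "0 < b" "b < a" and r: "r > 0" and u: "cmod z = 1" "cmod w = 1" and ne: "z \<noteq> w"
  shows "line_tangent (param a b z) (param a b w) (param a b \<zeta>) r \<longleftrightarrow>
    chord_tangent \<zeta> (r\<^sup>2 * (a\<^sup>2 - b\<^sup>2) / (a\<^sup>2 * b\<^sup>2)) ((a\<^sup>2 + b\<^sup>2) / (a\<^sup>2 - b\<^sup>2)) z w"
proof -
  define m where "m = r\<^sup>2 * (a\<^sup>2 - b\<^sup>2) / (a\<^sup>2 * b\<^sup>2)"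
  define k where "k = (a\<^sup>2 + b\<^sup>2) / (a\<^sup>2 - b\<^sup>2)"
  have c: "a\<^sup>2 - b\<^sup>2 > 0" using ab by (simp add: power_strict_mono)
  have mr: "m * (a\<^sup>2 * b\<^sup>2) = r\<^sup>2 * (a\<^sup>2 - b\<^sup>2)" using ab by (simp add: m_def)
  have "m * k * (a\<^sup>2 * b\<^sup>2) = r\<^sup>2 * (a\<^sup>2 - b\<^sup>2) * k" using mr by algebra
  also have "\<dots> = r\<^sup>2 * (a\<^sup>2 + b\<^sup>2)" using c by (simp add: k_def)
  finally have mkr: "m * k * (a\<^sup>2 * b\<^sup>2) = r\<^sup>2 * (a\<^sup>2 + b\<^sup>2)" .
  define cr where "cr = (Re z - Re \<zeta>) * (Im w - Im z) - (Im z - Im \<zeta>) * (Re w - Re z)"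
  define dx where "dx = Re w - Re z"
  define dy where "dy = Im w - Im z"
  have zz: "z * cnj z = 1" "w * cnj w = 1" using u by (simp_all add: complex_norm_square[symmetric])
  define d where "d = w - z"
  define e where "e = \<zeta> + z * w * cnj \<zeta> - z - w"
  have d0: "d \<noteq> 0" "z * w \<noteq> 0" using ne u d_def by auto
  have cr: "2 * \<i> * of_real cr = (cnj z - cnj \<zeta>) * (w - z) - (z - \<zeta>) * (cnj w - cnj z)"
    by (simp add: complex_eq_iff cr_def algebra_simps)
  have cr': "(z * w) * (2 * \<i> * of_real cr) = - (d * e)"
    unfolding cr d_def e_def using zz by algebra
  have dx: "2 * of_real dx = (w - z) + (cnj w - cnj z)" by (simp add: complex_eq_iff dx_def)
  have dx': "(z * w) * (2 * of_real dx) = d * (z * w - 1)"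
    unfolding dx d_def using zz by algebra
  have dy: "2 * \<i> * of_real dy = (w - z) - (cnj w - cnj z)" by (simp add: complex_eq_iff dy_def)
  have dy': "(z * w) * (2 * \<i> * of_real dy) = d * (z * w + 1)"
    unfolding dy d_def using zz by algebra
  have i2: "\<i>\<^sup>2 = - 1" by simp
  define a' where "a' = complex_of_real a"
  define b' where "b' = complex_of_real b"
  define r' where "r' = complex_of_real r"
  define m' where "m' = complex_of_real m"
  define k' where "k' = complex_of_real k"
  have ab0: "a' \<noteq> 0" "b' \<noteq> 0" using ab by (simp_all add: a'_def b'_def)
  have mr': "m' * (a'\<^sup>2 * b'\<^sup>2) = r'\<^sup>2 * (a'\<^sup>2 - b'\<^sup>2)"
    using arg_cong[OF mr, of complex_of_real] unfolding a'_def b'_def r'_def m'_def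
    by (simp only: of_real_mult of_real_power of_real_diff)
  have mkr': "m' * k' * (a'\<^sup>2 * b'\<^sup>2) = r'\<^sup>2 * (a'\<^sup>2 + b'\<^sup>2)"
    using arg_cong[OF mkr, of complex_of_real] unfolding a'_def b'_def r'_def m'_def k'_def
    by (simp only: of_real_mult of_real_power of_real_add)
  \<comment> \<open>\<open>L\<close> vanishes for a tangent line and \<open>R\<close> for a tangent
    chord; they differ by nonzero factors only.\<close>
  define L where "L = a'\<^sup>2 * b'\<^sup>2 * (of_real cr)\<^sup>2 - r'\<^sup>2 * (a'\<^sup>2 * (of_real dx)\<^sup>2 + b'\<^sup>2 * (of_real dy)\<^sup>2)"
  define R where "R = e\<^sup>2 - (2 * m' * k' * (z * w) - m' * (1 + (z * w)\<^sup>2))"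
  have "a'\<^sup>2 * b'\<^sup>2 * d\<^sup>2 * R = a'\<^sup>2 * b'\<^sup>2 * (d * e)\<^sup>2
      + r'\<^sup>2 * (a'\<^sup>2 * (d * (z * w - 1))\<^sup>2 - b'\<^sup>2 * (d * (z * w + 1))\<^sup>2)"
    unfolding R_def using mr' mkr' by algebra
  also have "\<dots> = - 4 * (z * w)\<^sup>2 * L"
    unfolding dx'[symmetric] dy'[symmetric] L_def using cr' i2 by algebra
  finally have LR': "a'\<^sup>2 * b'\<^sup>2 * d\<^sup>2 * R = - 4 * (z * w)\<^sup>2 * L" .
  have LR: "L = 0 \<longleftrightarrow> R = 0"
  proof -
    have "R = 0 \<longleftrightarrow> a'\<^sup>2 * b'\<^sup>2 * d\<^sup>2 * R = 0" using ab0 d0 by simp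
    also have "\<dots> \<longleftrightarrow> L = 0" unfolding LR' using d0 by simp
    finally show ?thesis by simp
  qed
  have "line_tangent (param a b z) (param a b w) (param a b \<zeta>) r \<longleftrightarrow>
      ((a * Re z - a * Re \<zeta>) * (b * Im w - b * Im z) - (b * Im z - b * Im \<zeta>) * (a * Re w - a * Re z))\<^sup>2
      = r\<^sup>2 * ((a * Re w - a * Re z)\<^sup>2 + (b * Im w - b * Im z)\<^sup>2)"
    unfolding param_def using ab ne r by (intro line_tangent_iff) (auto simp: complex_eq_iff)
  also have "\<dots> \<longleftrightarrow> a\<^sup>2 * b\<^sup>2 * cr\<^sup>2 - r\<^sup>2 * (a\<^sup>2 * dx\<^sup>2 + b\<^sup>2 * dy\<^sup>2) = 0"
  proof -
    have "((a * Re z - a * Re \<zeta>) * (b * Im w - b * Im z) - (b * Im z - b * Im \<zeta>) * (a * Re w - a * Re z))\<^sup>2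
      - r\<^sup>2 * ((a * Re w - a * Re z)\<^sup>2 + (b * Im w - b * Im z)\<^sup>2)
      = a\<^sup>2 * b\<^sup>2 * cr\<^sup>2 - r\<^sup>2 * (a\<^sup>2 * dx\<^sup>2 + b\<^sup>2 * dy\<^sup>2)"
      unfolding cr_def dx_def dy_def by algebra
    thus ?thesis by auto
  qed
  also have "\<dots> \<longleftrightarrow> complex_of_real (a\<^sup>2 * b\<^sup>2 * cr\<^sup>2 - r\<^sup>2 * (a\<^sup>2 * dx\<^sup>2 + b\<^sup>2 * dy\<^sup>2)) = 0"
    by (simp only: of_real_eq_0_iff)
  also have "\<dots> \<longleftrightarrow> L = 0"
    unfolding L_def a'_def b'_def r'_def by simp
  also have "\<dots> \<longleftrightarrow> chord_tangent \<zeta> m k z w"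
    unfolding LR R_def chord_tangent_def e_def m'_def k'_def by simp
  finally show ?thesis unfolding m_def k_def .
qed

text \<open>Strict convexity: a combination s \<open>z1\<close> + (1 - s) \<open>z3\<close> has
  squared modulus 1 - s (1 - s) |\<open>z1 - z3\<close>|^2, which is 1 only at the
  endpoints.\<close>

lemma not_collinear_param:
  assumes ab: "a \<noteq> 0" "b \<noteq> 0" and u: "cmod z1 = 1" "cmod z2 = 1" "cmod z3 = 1"
    and ne: "z1 \<noteq> z2" "z2 \<noteq> z3" "z3 \<noteq> z1"
  shows "\<not> collinear {param a b z1, param a b z2, param a b z3}"
proof
  assume "collinear {param a b z1, param a b z2, param a b z3}"
  then obtain s where "param a b z2 = s *\<^sub>R param a b z1 + (1 - s) *\<^sub>R param a b z3"
    using ne ab by (auto simp: collinear_3_expand param_eq_iff)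
  hence "a * Re z2 = a * (s * Re z1 + (1 - s) * Re z3)" "b * Im z2 = b * (s * Im z1 + (1 - s) * Im z3)"
    by (simp_all add: param_def algebra_simps)
  hence s: "Re z2 = s * Re z1 + (1 - s) * Re z3" "Im z2 = s * Im z1 + (1 - s) * Im z3" using ab by simp_all
  have c: "(Re z1)\<^sup>2 + (Im z1)\<^sup>2 = 1" "(Re z2)\<^sup>2 + (Im z2)\<^sup>2 = 1" "(Re z3)\<^sup>2 + (Im z3)\<^sup>2 = 1"
    using u by (simp_all add: cmod_power2[symmetric])
  have "s * (1 - s) * ((Re z1 - Re z3)\<^sup>2 + (Im z1 - Im z3)\<^sup>2) = 0"
    using s c by algebra
  hence "s = 0 \<or> s = 1 \<or> z1 = z3" by (auto simp: sum_power2_eq_zero_iff complex_eq_iff)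
  thus False using s ne by (auto simp: complex_eq_iff)
qed

section \<open>Circumcentres of triangles inscribed in the ellipse\<close>

lemma equidistant_param_iff:
  assumes "cmod z = 1" "cmod w = 1"
  shows "dist (x, y) (param a b z) = dist (x, y) (param a b w) \<longleftrightarrow>
    2 * (a * x * (Re w - Re z) + b * y * (Im w - Im z)) = (a\<^sup>2 - b\<^sup>2) * ((Re w)\<^sup>2 - (Re z)\<^sup>2)"
proof -
  have c: "(Re z)\<^sup>2 + (Im z)\<^sup>2 = 1" "(Re w)\<^sup>2 + (Im w)\<^sup>2 = 1"
    using assms by (simp_all add: cmod_power2[symmetric])
  have "dist (x, y) (param a b z) = dist (x, y) (param a b w) \<longleftrightarrow>
     (x - a * Re z)\<^sup>2 + (y - b * Im z)\<^sup>2 = (x - a * Re w)\<^sup>2 + (y - b * Im w)\<^sup>2"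
    by (simp add: param_def dist_Pair_Pair dist_real_def)
  moreover have "(x - a * Re z)\<^sup>2 + (y - b * Im z)\<^sup>2 - ((x - a * Re w)\<^sup>2 + (y - b * Im w)\<^sup>2)
     = 2 * (a * x * (Re w - Re z) + b * y * (Im w - Im z)) - (a\<^sup>2 - b\<^sup>2) * ((Re w)\<^sup>2 - (Re z)\<^sup>2)"
    using c by algebra
  ultimately show ?thesis by auto
qed

lemma circumcenter_param:
  assumes ab: "a \<noteq> 0" "b \<noteq> 0" and u: "cmod z1 = 1" "cmod z2 = 1" "cmod z3 = 1"
    and ne: "z1 \<noteq> z2" "z2 \<noteq> z3" "z3 \<noteq> z1"
  defines "s \<equiv> z1 + z2 + z3 + cnj (z1 * z2 * z3)"
  shows "circumcenter (param a b z1) (param a b z2) (param a b z3)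
    = ((a\<^sup>2 - b\<^sup>2) / (4 * a) * Re s, - ((a\<^sup>2 - b\<^sup>2) / (4 * b) * Im s))"
proof -
  define X where "X = (a\<^sup>2 - b\<^sup>2) / (4 * a) * Re s"
  define Y where "Y = - ((a\<^sup>2 - b\<^sup>2) / (4 * b) * Im s)"
  have XY: "4 * (a * X) = (a\<^sup>2 - b\<^sup>2) * Re s" "4 * (b * Y) = - ((a\<^sup>2 - b\<^sup>2) * Im s)"
    using ab by (simp_all add: X_def Y_def)
  have eq: "dist (X, Y) (param a b z) = dist (X, Y) (param a b w)"
    if zw: "cmod z = 1" "cmod w = 1" "s = z + w + v + cnj (z * w * v)" for z w v
  proof -
    have zz: "z * cnj z = 1" "w * cnj w = 1" using zw by (simp_all add: complex_norm_square[symmetric])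
    have c: "(Re z)\<^sup>2 + (Im z)\<^sup>2 = 1" "(Re w)\<^sup>2 + (Im w)\<^sup>2 = 1"
      using zw by (simp_all add: cmod_power2[symmetric])
    \<comment> \<open>Since |\<open>z\<close>| = |\<open>w\<close>| = 1, the conjugated product
      times \<open>w - z\<close> is \<open>- cnj V\<close>. The third vertex thus contributes only
      the imaginary number \<open>V - cnj V\<close>, and the real part is the bisector equation of
      \<open>z\<close> and \<open>w\<close>.\<close>
    define V where "V = v * (w - z)"
    have "s * (w - z) = w\<^sup>2 - z\<^sup>2 + (V - cnj V)"
      using zz zw(3) unfolding V_def by simp algebra
    hence "Re (s * (w - z)) = Re (w\<^sup>2) - Re (z\<^sup>2)"
      by (simp only: plus_complex.sel minus_complex.sel cnj.sel)
    hence "Re s * (Re w - Re z) - Im s * (Im w - Im z) = 2 * (Re w)\<^sup>2 - 2 * (Re z)\<^sup>2"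
      using c unfolding Re_power2 by simp
    hence "4 * (2 * (a * X * (Re w - Re z) + b * Y * (Im w - Im z)))
        = 4 * ((a\<^sup>2 - b\<^sup>2) * ((Re w)\<^sup>2 - (Re z)\<^sup>2))"
      using XY by algebra
    thus ?thesis by (simp add: equidistant_param_iff zw)
  qed
  have eqs: "dist (X, Y) (param a b z1) = dist (X, Y) (param a b z2)"
      "dist (X, Y) (param a b z1) = dist (X, Y) (param a b z3)"
    using eq[of z1 z2 z3] eq[of z1 z3 z2] u by (simp_all add: s_def ac_simps)
  have "circumcenter (param a b z1) (param a b z2) (param a b z3) = (X, Y)"
    unfolding circumcenter_def
  proof (rule the_equality)
    show "dist (X, Y) (param a b z1) = dist (X, Y) (param a b z2) \<and>
          dist (X, Y) (param a b z1) = dist (X, Y) (param a b z3)"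
      using eqs ..
  next
    fix Q assume Q: "dist Q (param a b z1) = dist Q (param a b z2) \<and>
          dist Q (param a b z1) = dist Q (param a b z3)"
    obtain X' Y' where Q': "Q = (X', Y')" by (cases Q)
    \<comment> \<open>\<open>e\<close> is the rescaled difference of two candidate centres. The
      bisectors of \<open>z1\<close>, \<open>z2\<close> and of \<open>z1\<close>, \<open>z3\<close>
      give \<open>e = cnj e * z1 * w\<close> for two different \<open>w\<close>, hence
      \<open>e = 0\<close>.\<close>
    define e where "e = Complex (a * (X' - X)) (b * (Y' - Y))"
    have *: "e = cnj e * z1 * w"
      if w: "cmod w = 1" "w \<noteq> z1" "dist Q (param a b z1) = dist Q (param a b w)"
        "dist (X, Y) (param a b z1) = dist (X, Y) (param a b w)" for w
    proof -
      have zz: "z1 * cnj z1 = 1" "w * cnj w = 1" using u w by (simp_all add: complex_norm_square[symmetric])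
      have "a * (X' - X) * (Re w - Re z1) + b * (Y' - Y) * (Im w - Im z1) = 0"
        using w(3,4) unfolding Q' equidistant_param_iff[OF u(1) w(1)] by (simp add: algebra_simps)
      hence "cnj e * (w - z1) + e * (cnj w - cnj z1) = 0"
        by (simp add: e_def complex_eq_iff algebra_simps)
      hence "(w - z1) * (cnj e * z1 * w - e) = 0" using zz by algebra
      thus ?thesis using w by simp
    qed
    have "e = cnj e * z1 * z2" "e = cnj e * z1 * z3"
      using *[OF u(2)] *[OF u(3)] Q eqs ne by auto
    hence "cnj e * z1 * (z2 - z3) = 0" by algebra
    hence "cnj e = 0" using u ne by auto
    thus "Q = (X, Y)" using ab by (simp add: Q' e_def complex_eq_iff)
  qed
  thus ?thesis by (simp add: X_def Y_def)
qed

section \<open>Linear images of the unit circle and the locus\<close>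

text \<open>Singular vectors of \<open>W\<close>: the inner product of the two images and the
  difference of their squared norms are half the imaginary part and the real part of
  \<open>cnj (e\<^sup>2) * g\<close>. Choosing \<open>e\<^sup>2\<close> in the direction of
  \<open>g\<close> makes this number real and nonnegative.\<close>

lemma principal_direction_exists:
  fixes W :: "complex \<Rightarrow> 'a::real_inner"
  assumes W: "linear W"
  obtains e where "cmod e = 1" "W e \<bullet> W (\<i> * e) = 0" "norm (W (\<i> * e)) \<le> norm (W e)"
proof -
  define U where "U = W 1"
  define V where "V = W \<i>"
  define g where "g = Complex (U \<bullet> U - V \<bullet> V) (2 * (U \<bullet> V))"
  have "\<exists>e. cmod e = 1 \<and> of_real (cmod g) * e\<^sup>2 = g"
  proof (cases "g = 0")
    case False
    define h where "h = csqrt g"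
    have h: "h\<^sup>2 = g" "h \<noteq> 0" using False by (simp_all add: h_def)
    have "of_real (cmod g) * (h / of_real (cmod h))\<^sup>2 = g"
      using h by (simp add: power_divide flip: h(1)) (simp add: norm_power)
    thus ?thesis using h by (intro exI[of _ "h / of_real (cmod h)"]) (simp add: norm_divide)
  qed (auto intro: exI[of _ 1])
  then obtain e where e: "cmod e = 1" "of_real (cmod g) * e\<^sup>2 = g" by blast
  define x where "x = Re e" define y where "y = Im e"
  have xy: "x\<^sup>2 + y\<^sup>2 = 1" using e by (simp add: x_def y_def flip: cmod_power2)
  have g: "U \<bullet> U - V \<bullet> V = cmod g * (x\<^sup>2 - y\<^sup>2)" "U \<bullet> V = cmod g * (x * y)"
    using arg_cong[OF e(2), of Re] arg_cong[OF e(2), of Im]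
    by (simp_all add: g_def x_def y_def Re_power2 Im_power2)
  have We: "W e = x *\<^sub>R U + y *\<^sub>R V"
  proof -
    have "e = x *\<^sub>R 1 + y *\<^sub>R \<i>" by (simp add: complex_eq_iff x_def y_def)
    hence "W e = W (x *\<^sub>R 1 + y *\<^sub>R \<i>)" by simp
    thus ?thesis by (simp only: linear_add[OF W] linear_scale[OF W] U_def V_def)
  qed
  have Wie: "W (\<i> * e) = x *\<^sub>R V - y *\<^sub>R U"
  proof -
    have "\<i> * e = x *\<^sub>R \<i> - y *\<^sub>R 1" by (simp add: complex_eq_iff x_def y_def)
    hence "W (\<i> * e) = W (x *\<^sub>R \<i> - y *\<^sub>R 1)" by simp
    thus ?thesis by (simp only: linear_diff[OF W] linear_scale[OF W] U_def V_def)
  qed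
  have "W e \<bullet> W (\<i> * e) = (x\<^sup>2 - y\<^sup>2) * (U \<bullet> V) - x * y * (U \<bullet> U - V \<bullet> V)"
    unfolding We Wie by (simp add: inner_simps inner_commute power2_eq_square algebra_simps)
  also have "\<dots> = 0" unfolding g by algebra
  finally have 1: "W e \<bullet> W (\<i> * e) = 0" .
  have "W e \<bullet> W e - W (\<i> * e) \<bullet> W (\<i> * e) = (x\<^sup>2 - y\<^sup>2) * (U \<bullet> U - V \<bullet> V) + 4 * x * y * (U \<bullet> V)"
    unfolding We Wie by (simp add: inner_simps inner_commute power2_eq_square algebra_simps)
  also have "\<dots> = cmod g * (x\<^sup>2 + y\<^sup>2)\<^sup>2" unfolding g by algebra
  also have "\<dots> \<ge> 0" by simp
  finally have "norm (W (\<i> * e)) \<le> norm (W e)" by (simp add: norm_eq_sqrt_inner)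
  from that[OF e(1) 1 this] show ?thesis .
qed

text \<open>In the orthonormal basis \<open>e\<close>, \<open>\<i> * e\<close> the coordinates of
  \<open>z\<close> are those of \<open>W z\<close> along \<open>u\<close> and \<open>w\<close>
  divided by \<open>p\<close> and \<open>q\<close>. Hence the position of \<open>M + W z\<close>
  relative to the ellipse is read off from |\<open>z\<close>|.\<close>

lemma ellipse_linear_image:
  assumes W: "linear W" "bij W" and e: "cmod e = 1" and orth: "W e \<bullet> W (\<i> * e) = 0"
    and le: "norm (W (\<i> * e)) \<le> norm (W e)"
  defines "p \<equiv> norm (W e)" and "q \<equiv> norm (W (\<i> * e))"
  defines "u \<equiv> (1 / p) *\<^sub>R W e" and "w \<equiv> (1 / q) *\<^sub>R W (\<i> * e)"
  shows "norm u = 1" "norm w = 1" "u \<bullet> w = 0" "p \<ge> q" "q > 0" "M + W e = M + p *\<^sub>R u"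
    "ellipse_form M u w p q (M + W z) = (cmod z)\<^sup>2"
    "ellipse M u w p q = (\<lambda>z. M + W z) ` {z. cmod z = 1}"
proof -
  have e0: "e \<noteq> 0" "\<i> * e \<noteq> 0" using e by auto
  have "W v \<noteq> 0" if "v \<noteq> 0" for v
    using W that by (metis bij_is_inj injD linear_0)
  hence p: "p > 0" and q: "q > 0" using e0 unfolding p_def q_def by simp_all
  show "norm u = 1" "norm w = 1" "u \<bullet> w = 0" "p \<ge> q" "q > 0" "M + W e = M + p *\<^sub>R u"
    using p q orth le by (simp_all add: u_def w_def p_def q_def)
  show form: "ellipse_form M u w p q (M + W z) = (cmod z)\<^sup>2" for z
  proof -
    define v where "v = z * cnj e"
    have "v * e = z * (e * cnj e)" by (simp add: v_def)
    hence "z = v * e" using e by (simp add: complex_norm_square[symmetric])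
    also have "\<dots> = Re v *\<^sub>R e + Im v *\<^sub>R (\<i> * e)" by (simp add: complex_eq_iff)
    finally have Wz: "W z = Re v *\<^sub>R W e + Im v *\<^sub>R W (\<i> * e)"
      by (simp only: linear_add[OF W(1)] linear_scale[OF W(1)])
    have "W z \<bullet> u = Re v * p" unfolding Wz u_def using p orth
      by (simp add: inner_simps inner_commute[of "W (\<i> * e)"] dot_square_norm p_def[symmetric] power2_eq_square)
    moreover have "W z \<bullet> w = Im v * q" unfolding Wz w_def using q orth
      by (simp add: inner_simps dot_square_norm q_def[symmetric] power2_eq_square)
    ultimately have "ellipse_form M u w p q (M + W z) = (Re v)\<^sup>2 + (Im v)\<^sup>2"
      using p q by (simp add: ellipse_form_def)
    also have "\<dots> = (cmod v)\<^sup>2" by (simp add: cmod_power2)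
    also have "\<dots> = (cmod z)\<^sup>2" using e by (simp add: v_def norm_mult)
    finally show ?thesis .
  qed
  have "X \<in> ellipse M u w p q \<longleftrightarrow> X \<in> (\<lambda>z. M + W z) ` {z. cmod z = 1}" for X
  proof -
    obtain z where "X - M = W z" using W(2) by (metis bij_pointE)
    hence X: "X = M + W z" by (simp add: algebra_simps)
    have "X \<in> ellipse M u w p q \<longleftrightarrow> cmod z = 1"
      unfolding X ellipse_def mem_Collect_eq form by (simp add: abs_square_eq_1)
    also have "\<dots> \<longleftrightarrow> X \<in> (\<lambda>z. M + W z) ` {z. cmod z = 1}"
      unfolding X using bij_is_inj[OF W(2)] by (auto dest: injD)
    finally show ?thesis .
  qed
  thus "ellipse M u w p q = (\<lambda>z. M + W z) ` {z. cmod z = 1}" by blast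
qed

section \<open>The circumcentre locus as an image of the unit circle\<close>

definition center_map :: "real \<Rightarrow> real \<Rightarrow> complex \<Rightarrow> point" where
  "center_map a b s = ((a\<^sup>2 - b\<^sup>2) / (4 * a) * Re s, - ((a\<^sup>2 - b\<^sup>2) / (4 * b) * Im s))"

text \<open>Averaging the interior condition over the highest and the lowest point of the circle
  gives \<open>(cmod \<zeta>)\<^sup>2 + (r / b)\<^sup>2 < 1\<close>. Nesting therefore selects the
  smaller root of the porism quadratic.\<close>

lemma poncelet_radius_porism:
  assumes ab: "0 < b" "b < a" and r: "r > 0"
    and sph: "sphere (param a b \<zeta>) r \<subseteq> std_ellipse_interior a b"
  shows "r\<^sup>2 * (a\<^sup>2 - b\<^sup>2) / (a\<^sup>2 * b\<^sup>2) < 1 - (cmod \<zeta>)\<^sup>2"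
proof -
  have "(cmod (\<zeta> + \<i> * of_real (\<sigma> * r / b)))\<^sup>2 < 1" if "\<bar>\<sigma>\<bar> = 1" for \<sigma> :: real
  proof -
    have "param a b (\<zeta> + \<i> * of_real (\<sigma> * r / b)) = (a * Re \<zeta>, b * Im \<zeta> + \<sigma> * r)"
      using ab by (simp add: param_def field_simps)
    also have "\<dots> \<in> sphere (param a b \<zeta>) r"
      using that r by (simp add: param_def dist_Pair_Pair dist_real_def abs_mult)
    finally show ?thesis using sph ab
      by (auto simp: param_in_std_ellipse_interior abs_square_less_1)
  qed
  from this[of 1] this[of "-1"]
  have "(Re \<zeta>)\<^sup>2 + (Im \<zeta> + r / b)\<^sup>2 < 1" "(Re \<zeta>)\<^sup>2 + (Im \<zeta> - r / b)\<^sup>2 < 1"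
    unfolding cmod_power2 by simp_all
  moreover have "(Im \<zeta> + r / b)\<^sup>2 + (Im \<zeta> - r / b)\<^sup>2 = 2 * (Im \<zeta>)\<^sup>2 + 2 * (r / b)\<^sup>2"
    by algebra
  ultimately have "(cmod \<zeta>)\<^sup>2 + (r / b)\<^sup>2 < 1" unfolding cmod_power2 by linarith
  moreover have "r\<^sup>2 * (a\<^sup>2 - b\<^sup>2) / (a\<^sup>2 * b\<^sup>2) < (r / b)\<^sup>2"
    using ab r by (simp add: power_divide divide_less_eq field_simps)
  ultimately show ?thesis by linarith
qed

text \<open>In the rescaled plane the circle becomes the ellipse with semi-axes \<open>r / a\<close>
  and \<open>r / b\<close>, which are the \<open>A\<close> and \<open>B\<close> of
  \<open>porism_inner_ellipse\<close>.\<close>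

lemma sphere_in_std_ellipse_interior:
  assumes ab: "0 < b" "b < a" and r: "r > 0"
    and k: "k = (a\<^sup>2 + b\<^sup>2) / (a\<^sup>2 - b\<^sup>2)" and m: "m = r\<^sup>2 * (a\<^sup>2 - b\<^sup>2) / (a\<^sup>2 * b\<^sup>2)"
    and P: "k > 1" "m > 0" "m < 1 - (cmod \<zeta>)\<^sup>2" "porism \<zeta> m k"
  shows "sphere (param a b \<zeta>) r \<subseteq> std_ellipse_interior a b"
proof
  fix X assume X: "X \<in> sphere (param a b \<zeta>) r"
  obtain z where z: "X = param a b z" using param_cases[of a b X] ab by auto
  have c: "a\<^sup>2 - b\<^sup>2 > 0" using ab by (simp add: power_strict_mono)
  define p where "p = a * (Re z - Re \<zeta>) / r"
  define q where "q = b * (Im z - Im \<zeta>) / r"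
  have "r\<^sup>2 = (dist (param a b \<zeta>) (param a b z))\<^sup>2" using X z by simp
  also have "\<dots> = (a * Re \<zeta> - a * Re z)\<^sup>2 + (b * Im \<zeta> - b * Im z)\<^sup>2"
    by (simp add: param_def dist_Pair_Pair dist_real_def)
  also have "\<dots> = (p * r)\<^sup>2 + (q * r)\<^sup>2" using r by (simp add: p_def q_def) algebra
  finally have "r\<^sup>2 * (p\<^sup>2 + q\<^sup>2) = r\<^sup>2 * 1" by algebra
  hence pq: "p\<^sup>2 + q\<^sup>2 = 1" using r by (subst (asm) mult_cancel_left) simp
  define D where "D = a\<^sup>2 - b\<^sup>2"
  have "k - 1 = 2 * b\<^sup>2 / D" "k + 1 = 2 * a\<^sup>2 / D"
    using c by (simp_all add: k D_def field_simps)
  hence "(r / a)\<^sup>2 = m * (k - 1) / 2" "(r / b)\<^sup>2 = m * (k + 1) / 2"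
    using c ab unfolding m power_divide D_def[symmetric] by simp_all
  from porism_inner_ellipse[OF P this pq]
  have "cmod (\<zeta> + Complex (r / a * p) (r / b * q)) < 1" .
  also have "\<zeta> + Complex (r / a * p) (r / b * q) = z"
    using ab r by (simp add: complex_eq_iff p_def q_def)
  finally show "X \<in> std_ellipse_interior a b" using ab by (simp add: z param_in_std_ellipse_interior)
qed

lemma circumcenter_locus_eq:
  assumes ab: "0 < b" "b < a" and z1: "cmod \<zeta> < 1"
    and k: "k = (a\<^sup>2 + b\<^sup>2) / (a\<^sup>2 - b\<^sup>2)"
    and P: "k > 1" "m > 0" "m < 1 - (cmod \<zeta>)\<^sup>2" "porism \<zeta> m k"
  shows "circumcenter_locus a b (param a b \<zeta>) =
    (\<lambda>\<omega>. center_map a b (2 * \<zeta> + (\<omega> * cnj (\<zeta>\<^sup>2 + of_real m) + cnj \<omega>))) ` {\<omega>. cmod \<omega> = 1}"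
    (is "?L = ?f ` _")
proof (intro set_eqI iffI)
  have ab0: "a \<noteq> 0" "b \<noteq> 0" using ab by auto
  have c: "a\<^sup>2 - b\<^sup>2 > 0" using ab by (simp add: power_strict_mono)
  fix X assume "X \<in> ?L"
  then obtain A B C r where X: "X = circumcenter A B C"
    and E: "A \<in> std_ellipse a b" "B \<in> std_ellipse a b" "C \<in> std_ellipse a b"
    and nc: "\<not> collinear {A, B, C}" and r: "r > 0"
    and sph: "sphere (param a b \<zeta>) r \<subseteq> std_ellipse_interior a b"
    and T: "line_tangent A B (param a b \<zeta>) r" "line_tangent B C (param a b \<zeta>) r"
      "line_tangent C A (param a b \<zeta>) r"
    unfolding circumcenter_locus_def poncelet_triangles_def by blast
  obtain x y z where xyz: "A = param a b x" "B = param a b y" "C = param a b z"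
    using param_cases[OF ab0] by metis
  have u: "cmod x = 1" "cmod y = 1" "cmod z = 1"
    using E ab0 by (simp_all add: xyz param_in_std_ellipse)
  hence nz: "x \<noteq> 0" "y \<noteq> 0" "z \<noteq> 0" by auto
  have ne: "x \<noteq> y" "y \<noteq> z" "z \<noteq> x" using nc xyz by (auto simp: insert_commute)
  define m' where "m' = r\<^sup>2 * (a\<^sup>2 - b\<^sup>2) / (a\<^sup>2 * b\<^sup>2)"
  have m': "m' > 0" using c r ab by (simp add: m'_def)
  have T': "chord_tangent \<zeta> m' k x y" "chord_tangent \<zeta> m' k y z" "chord_tangent \<zeta> m' k z x"
    using T unfolding xyz m'_def k
    by (simp_all only: line_tangent_param_iff[OF ab r u(1,2) ne(1)]
        line_tangent_param_iff[OF ab r u(2,3) ne(2)] line_tangent_param_iff[OF ab r u(3,1) ne(3)])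
  note rel = tangent_triangle_relations[OF m' P(1) nz ne T']
  \<comment> \<open>The radius of the given triangle is arbitrary a priori; closing and nesting
    leave only one possible value.\<close>
  have "m' = m"
    using porism_root_unique[OF P(1) _ rel(2) P(3,4)] poncelet_radius_porism[OF ab r sph] by (simp add: m'_def)
  hence "X = ?f (x * y * z)"
    using rel(1) unfolding X xyz circumcenter_param[OF ab0 u ne] center_map_def by (simp add: add.assoc)
  moreover have "cmod (x * y * z) = 1" using u by (simp add: norm_mult)
  ultimately show "X \<in> ?f ` {\<omega>. cmod \<omega> = 1}" by blast
next
  have ab0: "a \<noteq> 0" "b \<noteq> 0" using ab by auto
  have c: "a\<^sup>2 - b\<^sup>2 > 0" using ab by (simp add: power_strict_mono)
  fix X assume "X \<in> ?f ` {\<omega>. cmod \<omega> = 1}"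
  then obtain \<omega> where X: "X = ?f \<omega>" and \<omega>: "cmod \<omega> = 1" by blast
  obtain x y z where u: "cmod x = 1" "cmod y = 1" "cmod z = 1" and ne: "x \<noteq> y" "y \<noteq> z" "z \<noteq> x"
    and T: "chord_tangent \<zeta> m k x y" "chord_tangent \<zeta> m k y z" "chord_tangent \<zeta> m k z x"
    and e: "x + y + z = 2 * \<zeta> + \<omega> * cnj (\<zeta>\<^sup>2 + of_real m)" "x * y * z = \<omega>"
    using tangent_triangle_exists[OF P z1 \<omega>] by metis
  define r where "r = sqrt (m * (a\<^sup>2 * b\<^sup>2) / (a\<^sup>2 - b\<^sup>2))"
  have r: "r > 0" using P(2) c ab by (simp add: r_def)
  have "r\<^sup>2 = m * (a\<^sup>2 * b\<^sup>2) / (a\<^sup>2 - b\<^sup>2)" using P(2) c ab by (simp add: r_def)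
  hence m: "m = r\<^sup>2 * (a\<^sup>2 - b\<^sup>2) / (a\<^sup>2 * b\<^sup>2)" using c ab by simp
  have "sphere (param a b \<zeta>) r \<subseteq> std_ellipse_interior a b"
    by (rule sphere_in_std_ellipse_interior[OF ab r k m P])
  moreover have "line_tangent (param a b x) (param a b y) (param a b \<zeta>) r"
      "line_tangent (param a b y) (param a b z) (param a b \<zeta>) r"
      "line_tangent (param a b z) (param a b x) (param a b \<zeta>) r"
    using T unfolding m k
    by (simp_all only: line_tangent_param_iff[OF ab r u(1,2) ne(1)]
        line_tangent_param_iff[OF ab r u(2,3) ne(2)] line_tangent_param_iff[OF ab r u(3,1) ne(3)])
  moreover have "\<not> collinear {param a b x, param a b y, param a b z}"
    by (rule not_collinear_param[OF ab0 u ne])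
  ultimately have "(param a b x, param a b y, param a b z) \<in> poncelet_triangles a b (param a b \<zeta>)"
    using r u ab0 by (auto simp: poncelet_triangles_def param_in_std_ellipse)
  moreover have "X = circumcenter (param a b x) (param a b y) (param a b z)"
    unfolding X circumcenter_param[OF ab0 u ne] center_map_def using e by (simp add: add.assoc)
  ultimately show "X \<in> ?L" unfolding circumcenter_locus_def by blast
qed

section \<open>Position of the centre\<close>

text \<open>The inverse solves the equation together with its conjugate, a linear system with
  determinant 1 - |\<open>p\<close>|^2 up to sign.\<close>

lemma circle_image_bij:
  fixes p :: complex
  assumes "cmod p < 1"
  shows "bij (\<lambda>z. z * cnj p + cnj z)"
proof (rule bij_betw_byWitness[where f' = "\<lambda>w. (cnj w - p * w) / (1 - p * cnj p)"])
  have "(cmod p)\<^sup>2 \<noteq> 1" using assms by (auto simp: abs_square_eq_1)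
  hence p: "1 - p * cnj p \<noteq> 0"
    by (metis complex_norm_square eq_iff_diff_eq_0 of_real_eq_1_iff)
  hence p': "1 - cnj p * p \<noteq> 0" by (simp add: mult.commute)
  show "\<forall>z\<in>UNIV. (cnj (z * cnj p + cnj z) - p * (z * cnj p + cnj z)) / (1 - p * cnj p) = z"
    using p by (simp add: field_simps)
  show "\<forall>w\<in>UNIV. (cnj w - p * w) / (1 - p * cnj p) * cnj p + cnj ((cnj w - p * w) / (1 - p * cnj p)) = w"
  proof
    fix w
    have "(cnj w - p * w) / (1 - p * cnj p) * cnj p + cnj ((cnj w - p * w) / (1 - p * cnj p))
        = ((cnj w - p * w) * cnj p + (w - cnj p * cnj w)) / (1 - p * cnj p)"
      by (simp add: add_divide_distrib mult.commute)
    also have "\<dots> = w" using p by (simp add: field_simps)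
    finally show "(cnj w - p * w) / (1 - p * cnj p) * cnj p + cnj ((cnj w - p * w) / (1 - p * cnj p)) = w" .
  qed
qed auto

lemma center_map_linear: "linear (center_map a b)"
  by (rule linearI) (simp_all add: center_map_def algebra_simps add_divide_distrib diff_divide_distrib)

lemma center_map_bij:
  assumes "0 < b" "b < a"
  shows "bij (center_map a b)"
proof -
  define D where "D = a\<^sup>2 - b\<^sup>2"
  have D: "D > 0" using assms by (simp add: D_def power_strict_mono)
  show ?thesis
    unfolding center_map_def D_def[symmetric]
    by (rule bij_betw_byWitness[where f' = "\<lambda>X. Complex (4 * a / D * fst X) (- (4 * b / D * snd X))"])
      (use assms D in auto)
qed

text \<open>The porism quadratic takes the value \<open>(1 - |\<zeta>|\<^sup>2) (1 - F)\<close> at \<open>\<nu>\<close>, and \<open>m\<close> is its smaller root.\<close>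

lemma porism_discriminant_sign:
  assumes k: "k > 1" and m: "m > 0" "m < 1 - (cmod \<zeta>)\<^sup>2" "porism \<zeta> m k" and z: "cmod \<zeta> < 1"
  defines "\<nu> \<equiv> 2 * (k * (cmod \<zeta>)\<^sup>2 - Re (\<zeta>\<^sup>2))"
    and "F \<equiv> ((2 * k - 1) * Re \<zeta>)\<^sup>2 + ((2 * k + 1) * Im \<zeta>)\<^sup>2"
  shows "F < 1 \<Longrightarrow> \<nu> < m" "F = 1 \<Longrightarrow> \<nu> = m \<and> 1 - (cmod \<zeta>)\<^sup>2 = 2 * k * m" "F > 1 \<Longrightarrow> m < \<nu>"
proof -
  define n where "n = (cmod \<zeta>)\<^sup>2"
  define \<rho> where "\<rho> = Re (\<zeta>\<^sup>2)"
  define t where "t = 1 - n"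
  have \<nu>: "\<nu> = 2 * (k * n - \<rho>)" by (simp add: \<nu>_def n_def \<rho>_def)
  have "\<rho> \<le> n" unfolding \<rho>_def n_def by (rule Re_power2_le_cmod)
  hence kt: "t < k - \<rho>" unfolding t_def using k by argo
  have t0: "t > 0" using z by (simp add: t_def n_def abs_square_less_1)
  have mt: "m < t" using m(2) by (simp add: t_def n_def)
  have h: "m\<^sup>2 - 2 * m * (k - \<rho>) + t\<^sup>2 = 0" using m(3) by (simp add: porism_def n_def \<rho>_def t_def)
  have F: "t * (1 - F) = t * (t - 2 * k * \<nu>)"
    unfolding F_def \<nu>_def t_def n_def cmod_power2 Re_power2 by algebra
  hence F': "1 - F = t - 2 * k * \<nu>" using t0 by simp
  have prod: "(m - \<nu>) * (2 * (k - \<rho>) - m - \<nu>) = t * (1 - F)"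
    unfolding F using h \<nu> t_def by algebra
  \<comment> \<open>This factor is the larger root \<open>2 * (k - \<rho>) - m\<close> minus \<nu>.
    Once it is positive, the sign of \<open>1 - F\<close> decides on which side of \<open>m\<close>
    the value \<nu> lies.\<close>
  have pos: "2 * (k - \<rho>) - m - \<nu> > 0" if "\<nu> < t" using that mt kt by argo
  have \<nu>t: "\<nu> < t" if "2 * k * \<nu> \<le> t"
  proof (rule ccontr)
    assume "\<not> \<nu> < t"
    hence "2 * k * t \<le> 2 * k * \<nu>" using k by simp
    moreover have "1 * t < (2 * k) * t" using k t0 by (intro mult_strict_right_mono) auto
    ultimately show False using that by simp
  qed
  show "\<nu> < m" if "F < 1"
  proof -
    have "2 * (k - \<rho>) - m - \<nu> > 0" using F' that by (intro pos \<nu>t) simp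
    moreover have "(m - \<nu>) * (2 * (k - \<rho>) - m - \<nu>) > 0" unfolding prod using t0 that by simp
    ultimately show ?thesis by (simp add: zero_less_mult_iff)
  qed
  show "\<nu> = m \<and> 1 - (cmod \<zeta>)\<^sup>2 = 2 * k * m" if "F = 1"
  proof -
    have "2 * (k - \<rho>) - m - \<nu> > 0" using F' that by (intro pos \<nu>t) simp
    moreover have "(m - \<nu>) * (2 * (k - \<rho>) - m - \<nu>) = 0" unfolding prod using that by simp
    ultimately have "\<nu> = m" by simp
    thus ?thesis using F' that by (simp add: t_def n_def)
  qed
  show "m < \<nu>" if "F > 1"
  proof (rule ccontr)
    assume "\<not> m < \<nu>"
    hence "\<nu> \<le> m" by simp
    hence "2 * (k - \<rho>) - m - \<nu> > 0" using mt by (intro pos) simp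
    hence "(m - \<nu>) * (2 * (k - \<rho>) - m - \<nu>) \<ge> 0" using \<open>\<nu> \<le> m\<close> by simp
    moreover have "t * (1 - F) < 0" using t0 that by (simp add: mult_pos_neg)
    ultimately show False using prod by simp
  qed
qed

text \<open>\<omega> is the parameter that the locus map sends to \<open>C\<close>. Eliminating
  \<open>cnj \<omega>\<close> with the conjugate equation gives (1 - |p|^2) \<omega> = 2 k (\<zeta>
  - p \<open>cnj \<zeta>\<close>), where 1 - |p|^2 = 2 \<open>N\<close>. So \<open>m - \<nu>\<close>
  has the sign of 1 - |\<omega>|^2.\<close>

lemma center_preimage:
  assumes k: "k > 1" and m: "m > 0" "m < 1 - (cmod \<zeta>)\<^sup>2" "porism \<zeta> m k" and z: "cmod \<zeta> < 1"
    and pre: "\<omega> * cnj (\<zeta>\<^sup>2 + of_real m) + cnj \<omega> = 2 * of_real k * cnj \<zeta>"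
  defines "\<nu> \<equiv> 2 * (k * (cmod \<zeta>)\<^sup>2 - Re (\<zeta>\<^sup>2))"
    and "N \<equiv> (1 - (cmod \<zeta>)\<^sup>2) - m * k"
  shows "N > 0" "of_real N * \<omega> = of_real k * (of_real (1 - (cmod \<zeta>)\<^sup>2) * \<zeta> - of_real m * cnj \<zeta>)"
    "N\<^sup>2 * (1 - (cmod \<omega>)\<^sup>2) = m * (k\<^sup>2 - 1) * (m - \<nu>)"
proof -
  define p where "p = \<zeta>\<^sup>2 + of_real m"
  define t where "t = 1 - (cmod \<zeta>)\<^sup>2"
  define T where "T = complex_of_real t"
  define M where "M = complex_of_real m"
  define K where "K = complex_of_real k"
  show N: "N > 0" unfolding N_def using porism_root_bound[OF k m(2,3) z] by simp
  have T: "T = 1 - \<zeta> * cnj \<zeta>" unfolding T_def t_def of_real_diff complex_norm_square by simp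
  have "(cmod p)\<^sup>2 = 1 - 2 * N" unfolding p_def N_def by (rule porism_cmod[OF m(3)])
  hence "p * cnj p = of_real (1 - 2 * N)" by (simp only: complex_norm_square[symmetric])
  hence pp: "p * cnj p = 1 - 2 * of_real N" by simp
  have pre': "cnj \<omega> * p + \<omega> = 2 * K * \<zeta>"
    using arg_cong[OF pre, of cnj] by (simp add: p_def K_def)
  have "(1 - p * cnj p) * \<omega> = 2 * K * (\<zeta> - p * cnj \<zeta>)"
    using pre pre' unfolding p_def[symmetric] K_def[symmetric] by algebra
  also have "\<zeta> - p * cnj \<zeta> = T * \<zeta> - M * cnj \<zeta>"
    unfolding p_def T M_def by algebra
  finally have "2 * (of_real N * \<omega>) = 2 * (K * (T * \<zeta> - M * cnj \<zeta>))" unfolding pp by algebra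
  hence N\<omega>: "of_real N * \<omega> = K * (T * \<zeta> - M * cnj \<zeta>)" by (subst (asm) mult_cancel_left) simp
  thus "of_real N * \<omega> = of_real k * (of_real (1 - (cmod \<zeta>)\<^sup>2) * \<zeta> - of_real m * cnj \<zeta>)"
    by (simp add: K_def T_def M_def t_def)
  have "N\<^sup>2 * (cmod \<omega>)\<^sup>2 = (cmod (of_real N * \<omega>))\<^sup>2"
    by (simp add: norm_mult power_mult_distrib)
  also have "\<dots> = k\<^sup>2 * (cmod (T * \<zeta> - M * cnj \<zeta>))\<^sup>2"
    unfolding N\<omega> K_def by (simp add: norm_mult power_mult_distrib)
  also have "(cmod (T * \<zeta> - M * cnj \<zeta>))\<^sup>2 = (t - m)\<^sup>2 * (Re \<zeta>)\<^sup>2 + (t + m)\<^sup>2 * (Im \<zeta>)\<^sup>2"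
    unfolding T_def M_def cmod_power2 by (simp add: power2_eq_square algebra_simps)
  finally have "N\<^sup>2 * (cmod \<omega>)\<^sup>2 = k\<^sup>2 * ((t - m)\<^sup>2 * (Re \<zeta>)\<^sup>2 + (t + m)\<^sup>2 * (Im \<zeta>)\<^sup>2)" .
  moreover have "t = 1 - ((Re \<zeta>)\<^sup>2 + (Im \<zeta>)\<^sup>2)" by (simp add: t_def cmod_power2)
  moreover have "m\<^sup>2 - 2 * m * (k - ((Re \<zeta>)\<^sup>2 - (Im \<zeta>)\<^sup>2)) + t\<^sup>2 = 0"
    using m(3) by (simp add: porism_def t_def Re_power2)
  moreover have "\<nu> = 2 * (k * ((Re \<zeta>)\<^sup>2 + (Im \<zeta>)\<^sup>2) - ((Re \<zeta>)\<^sup>2 - (Im \<zeta>)\<^sup>2))"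
    by (simp add: \<nu>_def Re_power2 cmod_power2)
  moreover have "N = t - m * k" by (simp add: N_def t_def)
  ultimately show "N\<^sup>2 * (1 - (cmod \<omega>)\<^sup>2) = m * (k\<^sup>2 - 1) * (m - \<nu>)" by algebra
qed

text \<open>Up to the factor 1/(2ab) the vectors are a^2 + b^2 times (bx, ay) and 2ab times (-ay,
  bx), with x, y the coordinates of \<zeta>; they are orthogonal, and 2ab < a^2 + b^2 compares their
  lengths. They serve as the images of \<omega> and \<open>\<i> * \<omega>\<close> when |\<omega>| =
  1.\<close>

lemma major_axis_through_center:
  assumes ab: "0 < b" "b < a" and k: "k = (a\<^sup>2 + b\<^sup>2) / (a\<^sup>2 - b\<^sup>2)" and z: "\<zeta> \<noteq> 0"
  shows "center_map a b (2 * of_real k * cnj \<zeta>) \<bullet> center_map a b (2 * \<i> * (\<zeta> - of_real k * cnj \<zeta>)) = 0"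
    and "norm (center_map a b (2 * \<i> * (\<zeta> - of_real k * cnj \<zeta>))) < norm (center_map a b (2 * of_real k * cnj \<zeta>))"
proof -
  define D where "D = a\<^sup>2 - b\<^sup>2"
  have D: "D > 0" using ab by (simp add: D_def power_strict_mono)
  define x where "x = Re \<zeta>" define y where "y = Im \<zeta>"
  have Dk: "D * k = a\<^sup>2 + b\<^sup>2" using D by (simp add: k D_def)
  have Dk1: "D * (k - 1) = 2 * b\<^sup>2" "D * (k + 1) = 2 * a\<^sup>2" using Dk D_def by algebra+
  have "center_map a b (2 * of_real k * cnj \<zeta>) = (D * k * x / (2 * a), D * k * y / (2 * b))"
    by (simp add: center_map_def D_def[symmetric] x_def y_def)
  hence 1: "center_map a b (2 * of_real k * cnj \<zeta>)
      = (1 / (2 * a * b)) *\<^sub>R ((a\<^sup>2 + b\<^sup>2) * (b * x), (a\<^sup>2 + b\<^sup>2) * (a * y))"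
    using ab unfolding Dk by simp
  have "center_map a b (2 * \<i> * (\<zeta> - of_real k * cnj \<zeta>))
      = (- (D * (k + 1)) * y / (2 * a), D * (k - 1) * x / (2 * b))"
    using ab by (simp add: center_map_def D_def[symmetric] x_def y_def field_simps)
  hence 2: "center_map a b (2 * \<i> * (\<zeta> - of_real k * cnj \<zeta>))
      = (1 / (2 * a * b)) *\<^sub>R ((2 * a * b) * (- (a * y)), (2 * a * b) * (b * x))"
    using ab unfolding Dk1 by (simp add: power2_eq_square)
  show "center_map a b (2 * of_real k * cnj \<zeta>) \<bullet> center_map a b (2 * \<i> * (\<zeta> - of_real k * cnj \<zeta>)) = 0"
    unfolding 1 2 by (simp add: algebra_simps)
  have "(x, y) \<noteq> (0, 0)" using z by (auto simp: x_def y_def complex_eq_iff)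
  hence s: "(b * x)\<^sup>2 + (a * y)\<^sup>2 > 0" using ab by (auto simp: sum_power2_gt_zero_iff)
  have "0 < (a - b)\<^sup>2" using ab by simp
  hence "2 * a * b < a\<^sup>2 + b\<^sup>2" by (simp add: power2_eq_square algebra_simps)
  hence lt: "(2 * a * b)\<^sup>2 < (a\<^sup>2 + b\<^sup>2)\<^sup>2" using ab by (intro power_strict_mono) auto
  have "norm ((2 * a * b) * (- (a * y)), (2 * a * b) * (b * x)) = sqrt ((2 * a * b)\<^sup>2 * ((b * x)\<^sup>2 + (a * y)\<^sup>2))"
    by (simp add: norm_Pair power_mult_distrib algebra_simps)
  also have "\<dots> < sqrt ((a\<^sup>2 + b\<^sup>2)\<^sup>2 * ((b * x)\<^sup>2 + (a * y)\<^sup>2))"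
    using lt s by (intro real_sqrt_less_mono mult_strict_right_mono)
  also have "\<dots> = norm ((a\<^sup>2 + b\<^sup>2) * (b * x), (a\<^sup>2 + b\<^sup>2) * (a * y))"
    by (simp add: norm_Pair power_mult_distrib[of "a\<^sup>2 + b\<^sup>2"] distrib_left)
  finally show "norm (center_map a b (2 * \<i> * (\<zeta> - of_real k * cnj \<zeta>))) < norm (center_map a b (2 * of_real k * cnj \<zeta>))"
    unfolding 1 2 norm_scaleR using ab by (intro mult_strict_left_mono) auto
qed

theorem corollary5:
  fixes a b c xc yc :: real
  assumes "a > b" and "b > 0" and "c\<^sup>2 = a\<^sup>2 - b\<^sup>2"
    and "(xc, yc) \<in> std_ellipse_interior a b"
  shows "\<exists>M u w p q.
    norm u = 1 \<and> norm w = 1 \<and> u \<bullet> w = 0 \<and> p \<ge> q \<and> q > 0 \<and>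
    circumcenter_locus a b (xc, yc) = ellipse M u w p q \<and>
    ((xc, yc) \<in> std_ellipse (a * c\<^sup>2 / (a\<^sup>2 + 3 * b\<^sup>2)) (b * c\<^sup>2 / (3 * a\<^sup>2 + b\<^sup>2)) \<longrightarrow>
       p > q \<and> (xc, yc) \<in> {M + p *\<^sub>R u, M - p *\<^sub>R u}) \<and>
    ((xc, yc) \<in> std_ellipse_interior (a * c\<^sup>2 / (a\<^sup>2 + 3 * b\<^sup>2)) (b * c\<^sup>2 / (3 * a\<^sup>2 + b\<^sup>2)) \<longrightarrow>
       (xc, yc) \<in> ellipse_interior M u w p q) \<and>
    ((xc, yc) \<in> std_ellipse_exterior (a * c\<^sup>2 / (a\<^sup>2 + 3 * b\<^sup>2)) (b * c\<^sup>2 / (3 * a\<^sup>2 + b\<^sup>2)) \<longrightarrow>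
       (xc, yc) \<in> ellipse_exterior M u w p q)"
proof -
  have ab: "0 < b" "b < a" and ab0: "a \<noteq> 0" "b \<noteq> 0" using assms by auto
  have c: "c\<^sup>2 > 0" using ab unfolding assms(3) by (simp add: power_strict_mono)
  obtain \<zeta> where C: "(xc, yc) = param a b \<zeta>" using param_cases[OF ab0] by metis
  have z1: "cmod \<zeta> < 1" using assms(4) ab0 by (simp add: C param_in_std_ellipse_interior)
  define k where "k = (a\<^sup>2 + b\<^sup>2) / (a\<^sup>2 - b\<^sup>2)"
  have kc: "c\<^sup>2 * k = a\<^sup>2 + b\<^sup>2" using c unfolding k_def assms(3) by simp
  have k1: "k > 1" using c ab unfolding assms(3) k_def by simp
  obtain m where m: "m > 0" "m < 1 - (cmod \<zeta>)\<^sup>2" "porism \<zeta> m k"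
    using porism_root_exists[OF k1 z1] by blast
  define p where "p = \<zeta>\<^sup>2 + of_real m"
  have "(cmod p)\<^sup>2 < 1"
    using porism_cmod[OF m(3)] porism_root_bound[OF k1 m(2,3) z1] by (simp add: p_def)
  hence p1: "cmod p < 1" by (simp add: abs_square_less_1)
  define M where "M = center_map a b (2 * \<zeta>)"
  define V where "V z = z * cnj p + cnj z" for z
  define W where "W z = center_map a b (V z)" for z
  have linV: "linear V" by (rule linearI) (simp_all add: V_def algebra_simps scaleR_conv_of_real)
  have linW: "linear W"
    using linear_compose[OF linV center_map_linear[of a b]] by (simp add: W_def[abs_def] comp_def)
  have bijV: "bij V" using circle_image_bij[OF p1] by (simp add: V_def[abs_def])
  have bijW: "bij W"
    using bij_comp[OF bijV center_map_bij[OF ab]] by (simp add: W_def[abs_def] comp_def)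
  have locus: "circumcenter_locus a b (xc, yc) = (\<lambda>z. M + W z) ` {z. cmod z = 1}"
    unfolding C circumcenter_locus_eq[OF ab z1 k_def k1 m] M_def W_def V_def p_def
      linear_add[OF center_map_linear] ..
  \<comment> \<open>The offset of \<open>C\<close> from the centre \<open>M\<close> of the locus:
    \<open>c\<^sup>2 * (1 + k)\<close> and \<open>c\<^sup>2 * (k - 1)\<close> are
    \<open>2 * a\<^sup>2\<close> and \<open>2 * b\<^sup>2\<close>, which turns the coefficients of
    \<open>center_map\<close> back into \<open>a\<close> and \<open>b\<close>.\<close>
  have CM: "(xc, yc) = M + center_map a b (2 * of_real k * cnj \<zeta>)"
  proof -
    have "c\<^sup>2 * (1 + k) = 2 * a\<^sup>2" "c\<^sup>2 * (k - 1) = 2 * b\<^sup>2" using kc assms(3) by algebra+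
    moreover have "c\<^sup>2 / (4 * a) * ((1 + k) * (2 * Re \<zeta>)) = c\<^sup>2 * (1 + k) * Re \<zeta> / (2 * a)"
       "c\<^sup>2 / (4 * b) * ((k - 1) * (2 * Im \<zeta>)) = c\<^sup>2 * (k - 1) * Im \<zeta> / (2 * b)"
      by simp_all
    ultimately have "c\<^sup>2 / (4 * a) * ((1 + k) * (2 * Re \<zeta>)) = a * Re \<zeta>"
       "c\<^sup>2 / (4 * b) * ((k - 1) * (2 * Im \<zeta>)) = b * Im \<zeta>"
      using ab0 by (simp_all add: power2_eq_square)
    thus ?thesis unfolding C M_def
      by (simp add: param_def center_map_def assms(3)[symmetric] algebra_simps)
  qed
  obtain \<omega> where \<omega>: "V \<omega> = 2 * of_real k * cnj \<zeta>" using bijV by (metis bij_pointE)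
  have CW: "(xc, yc) = M + W \<omega>" using CM by (simp add: W_def \<omega>)
  define \<nu> where "\<nu> = 2 * (k * (cmod \<zeta>)\<^sup>2 - Re (\<zeta>\<^sup>2))"
  define N where "N = (1 - (cmod \<zeta>)\<^sup>2) - m * k"
  define F where "F = ((2 * k - 1) * Re \<zeta>)\<^sup>2 + ((2 * k + 1) * Im \<zeta>)\<^sup>2"
  note pre = center_preimage[OF k1 m z1 \<omega>[unfolded V_def p_def], folded \<nu>_def N_def]
  note sgn = porism_discriminant_sign[OF k1 m z1, folded \<nu>_def F_def]
  \<comment> \<open>The semi-axes are a/(2k - 1) and b/(2k + 1), so in the rescaled coordinates the
    level function is \<open>F\<close>.\<close>
  have form: "ellipse_form (0, 0) (1, 0) (0, 1) (a * c\<^sup>2 / (a\<^sup>2 + 3 * b\<^sup>2)) (b * c\<^sup>2 / (3 * a\<^sup>2 + b\<^sup>2)) (xc, yc) = F"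
  proof -
    have "c\<^sup>2 * (2 * k - 1) = a\<^sup>2 + 3 * b\<^sup>2" "c\<^sup>2 * (2 * k + 1) = 3 * a\<^sup>2 + b\<^sup>2"
      using kc assms(3) by algebra+
    thus ?thesis using ab0 c unfolding C ellipse_form_def param_def F_def
      by (simp flip: \<open>c\<^sup>2 * (2 * k - 1) = _\<close> \<open>c\<^sup>2 * (2 * k + 1) = _\<close>) (simp add: mult_ac)
  qed
  have pos: "m * (k\<^sup>2 - 1) > 0" "N\<^sup>2 > 0"
    using m(1) k1 pre(1) by (simp_all add: one_less_power)
  have inside: "cmod \<omega> < 1" if "F < 1"
  proof -
    have "N\<^sup>2 * (1 - (cmod \<omega>)\<^sup>2) > 0" unfolding pre(3) using pos sgn(1)[OF that] by simp
    thus ?thesis using pos by (simp add: zero_less_mult_iff abs_square_less_1)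
  qed
  have outside: "(cmod \<omega>)\<^sup>2 > 1" if "F > 1"
  proof -
    have "N\<^sup>2 * (1 - (cmod \<omega>)\<^sup>2) < 0" unfolding pre(3) using pos sgn(3)[OF that]
      by (intro mult_pos_neg) auto
    thus ?thesis using pos by (simp add: mult_less_0_iff)
  qed
  \<comment> \<open>For \<open>F = 1\<close> the principal direction must be \<omega> itself, so
    that \<open>C\<close> is the endpoint \<open>M + W e\<close>; otherwise any principal direction
    will do.\<close>
  obtain e where e: "cmod e = 1" "W e \<bullet> W (\<i> * e) = 0" "norm (W (\<i> * e)) \<le> norm (W e)"
    and major: "F = 1 \<Longrightarrow> e = \<omega> \<and> norm (W (\<i> * e)) < norm (W e)"
  proof (cases "F = 1")
    case True
    have \<nu>m: "\<nu> = m" and t: "1 - (cmod \<zeta>)\<^sup>2 = 2 * k * m" using sgn(2)[OF True] by auto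
    have "N\<^sup>2 * (1 - (cmod \<omega>)\<^sup>2) = 0" unfolding pre(3) \<nu>m by simp
    hence \<omega>1: "cmod \<omega> = 1" using pos by (simp add: abs_square_eq_1)
    have "N = m * k" by (simp add: N_def t)
    hence "of_real (m * k) * \<omega> = of_real (m * k) * (2 * of_real k * \<zeta> - cnj \<zeta>)"
      using pre(2) unfolding t by (simp add: algebra_simps)
    hence \<omega>': "\<omega> = 2 * of_real k * \<zeta> - cnj \<zeta>" using m(1) k1 by (subst (asm) mult_cancel_left) simp
    \<comment> \<open>Substituting \<open>V \<omega>\<close> removes \<open>p\<close>, and the
      explicit \<omega> gives the second vector of \<open>major_axis_through_center\<close>.\<close>
    have "V (\<i> * \<omega>) = \<i> * (V \<omega> - 2 * cnj \<omega>)" by (simp add: V_def algebra_simps)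
    also have "\<dots> = 2 * \<i> * (\<zeta> - of_real k * cnj \<zeta>)" unfolding \<omega> by (simp add: \<omega>' algebra_simps)
    finally have V': "V (\<i> * \<omega>) = 2 * \<i> * (\<zeta> - of_real k * cnj \<zeta>)" .
    have "\<zeta> \<noteq> 0" using True by (auto simp: F_def)
    from major_axis_through_center[OF ab k_def this]
    have "W \<omega> \<bullet> W (\<i> * \<omega>) = 0" "norm (W (\<i> * \<omega>)) < norm (W \<omega>)" by (simp_all only: W_def V' \<omega>)
    with \<omega>1 show ?thesis by (intro that[of \<omega>]) auto
  next
    case False
    thus ?thesis using principal_direction_exists[OF linW] that by blast
  qed
  note E = ellipse_linear_image[OF linW bijW e]
  show ?thesis
  proof (intro exI conjI impI)
    show "circumcenter_locus a b (xc, yc) = ellipse M ((1 / norm (W e)) *\<^sub>R W e)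
        ((1 / norm (W (\<i> * e))) *\<^sub>R W (\<i> * e)) (norm (W e)) (norm (W (\<i> * e)))"
      unfolding locus E(8) ..
  next
    assume "(xc, yc) \<in> std_ellipse (a * c\<^sup>2 / (a\<^sup>2 + 3 * b\<^sup>2)) (b * c\<^sup>2 / (3 * a\<^sup>2 + b\<^sup>2))"
    hence "F = 1" unfolding ellipse_def form[symmetric] by simp
    note * = major[OF this]
    show "norm (W e) > norm (W (\<i> * e))" by (rule conjunct2[OF *])
    have "(xc, yc) = M + W e" using * CW by simp
    thus "(xc, yc) \<in> {M + norm (W e) *\<^sub>R ((1 / norm (W e)) *\<^sub>R W e), M - norm (W e) *\<^sub>R ((1 / norm (W e)) *\<^sub>R W e)}"
      using E(6) by simp
  next
    assume "(xc, yc) \<in> std_ellipse_interior (a * c\<^sup>2 / (a\<^sup>2 + 3 * b\<^sup>2)) (b * c\<^sup>2 / (3 * a\<^sup>2 + b\<^sup>2))"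
    hence "F < 1" unfolding ellipse_interior_def form[symmetric] by simp
    from inside[OF this]
    show "(xc, yc) \<in> ellipse_interior M ((1 / norm (W e)) *\<^sub>R W e)
        ((1 / norm (W (\<i> * e))) *\<^sub>R W (\<i> * e)) (norm (W e)) (norm (W (\<i> * e)))"
      unfolding CW ellipse_interior_def mem_Collect_eq E(7) by (simp add: abs_square_less_1)
  next
    assume "(xc, yc) \<in> std_ellipse_exterior (a * c\<^sup>2 / (a\<^sup>2 + 3 * b\<^sup>2)) (b * c\<^sup>2 / (3 * a\<^sup>2 + b\<^sup>2))"
    hence "F > 1" unfolding ellipse_exterior_def form[symmetric] by simp
    from outside[OF this]
    show "(xc, yc) \<in> ellipse_exterior M ((1 / norm (W e)) *\<^sub>R W e)
        ((1 / norm (W (\<i> * e))) *\<^sub>R W (\<i> * e)) (norm (W e)) (norm (W (\<i> * e)))"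
      unfolding CW ellipse_exterior_def mem_Collect_eq E(7) .
  qed (use E in auto)
qed

end
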